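(* Let $\mu$ be a non-atomic and locally finite Borel measure on $\mathbb{R}^d$ with $\mu(R)=0$, and let $0<\theta\le1$. Let $(E_n)$ be a sequence of open subsets of $\mathbb{R}^d$. If $\mu_n$ are non-atomic Borel measures on $\mathbb{R}^d$, with $\operatorname{supp}\mu_n\subset E_n$, that converge weakly to the measure $\mu$, and if for every $0<\eta<\theta$ there is a constant $c_\eta$ such that \[ I_\mu^\eta(\mu_n)=\iint\mu(Q(x,y))^{-\eta}\,\mathrm{d}\mu_n(x)\,\mathrm{d}\mu_n(y)\le c_\eta \] for all $n$, then $\limsup_nE_n=\bigcap_{k\ge1}\bigcup_{n\ge k}E_n$ belongs to $\mathscr{G}_\mu^\theta$.
   Context: Fix a point $P=(p_1,\dots,p_d)\in\mathbb{R}^d$. For $n\in\mathbb{Z}$, $\mathscr{D}_n$ is the collection of half-open cubes $\prod_{i=1}^d[p_i+n_i2^{-n},\,p_i+(n_i+1)2^{-n})$ with $n_1,\dots,n_d\in\mathbb{Z}$, and $\mathscr{D}=\bigcup_{n\in\mathbb{Z}}\mathscr{D}_n$ (dyadic cubes). $R=\bigcup_{n\in\mathbb{Z}}\bigcup_{D\in\mathscr{D}_n}\partial D$ is the union of all boundaries of dyadic cubes. For $0<\theta\le1$ and $E\subset\mathbb{R}^d$, $\mathscr{M}_\mu^\theta(E)=\inf\{\sum_k\mu(D_k)^\theta : D_k\in\mathscr{D},\ E\subset\bigcup_kD_k\}$ (infimum over countable covers by dyadic cubes). For $0<\theta\le1$, a set $E\subset\mathbb{R}^d$ belongs to the class $\mathscr{G}_\mu^\theta$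 if $E$ is a $G_\delta$-set and $\mathscr{M}_\mu^\eta(E\cap D)=\mathscr{M}_\mu^\eta(D)$ for every $0<\eta<\theta$ and every $D\in\mathscr{D}$. For $x\ne y$ in $\mathbb{R}^d$, $Q(x,y)$ is the minimal (with respect to inclusion) element of $\mathscr{D}\cup\{\mathbb{R}^d\}$ containing both $x$ and $y$; $Q(x,x)=\emptyset$. Conventions: $0^{-\eta}=\infty$ and $\infty^{-\eta}=0$ for $\eta>0$. *)

theory Defs
  imports "HOL-Analysis.Analysis"
begin

section \<open>Measures on Euclidean space\<close>

definition locally_finite_measure :: "'a::topological_space measure \<Rightarrow> bool" where
  "locally_finite_measure M \<longleftrightarrow> (\<forall>x. \<exists>U. open U \<and> x \<in> U \<and> emeasure M U < \<infinity>)"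

definition measure_atom :: "'a measure \<Rightarrow> 'a set \<Rightarrow> bool" where
  "measure_atom M A \<longleftrightarrow> A \<in> sets M \<and> emeasure M A > 0 \<and>
     (\<forall>B\<in>sets M. B \<subseteq> A \<longrightarrow> emeasure M B = 0 \<or> emeasure M (A - B) = 0)"

definition nonatomic :: "'a measure \<Rightarrow> bool" where
  "nonatomic M \<longleftrightarrow> (\<nexists>A. measure_atom M A)"

definition measure_support :: "'a::topological_space measure \<Rightarrow> 'a set" where
  "measure_support M = {x. \<forall>U. open U \<longrightarrow> x \<in> U \<longrightarrow> emeasure M U > 0}"

text \<open>
  The limit measure is only locally finite, possibly of infinite total mass, so weak convergence
  is tested against continuous functions with compact support.
\<close>

definition weakly_converges ::
    "(nat \<Rightarrow> 'a::topological_space measure) \<Rightarrow> 'a measure \<Rightarrow> bool" where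
  "weakly_converges Ms M \<longleftrightarrow>
     (\<forall>f :: 'a \<Rightarrow> real. continuous_on UNIV f \<longrightarrow> compact (closure {x. f x \<noteq> 0}) \<longrightarrow>
        (\<forall>n. integrable (Ms n) f) \<and> integrable M f \<and>
        (\<lambda>n. integral\<^sup>L (Ms n) f) \<longlonglongrightarrow> integral\<^sup>L M f)"

text \<open>
  Real powers of extended nonnegative reals. In particular \<open>0\<close> to a negative power is \<open>\<infinity>\<close>,
  and \<open>\<infinity>\<close> to a negative power is \<open>0\<close> (whereas \<open>0 powr a = 0\<close> for all real \<open>a\<close>).
\<close>

definition ennreal_powr :: "ennreal \<Rightarrow> real \<Rightarrow> ennreal" where
  "ennreal_powr x a =
     (if a = 0 then 1
      else if x = 0 then (if a > 0 then 0 else \<infinity>)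
      else if x = \<infinity> then (if a > 0 then \<infinity> else 0)
      else ennreal (enn2real x powr a))"

section \<open>Dyadic cubes with base point \<open>P\<close>\<close>

definition dyadic_cubes_level :: "real ^ 'd \<Rightarrow> int \<Rightarrow> (real ^ 'd) set set" where
  "dyadic_cubes_level P n =
     {{x. \<forall>i. P $ i + of_int (m i) * 2 powi (- n) \<le> x $ i \<and>
              x $ i < P $ i + (of_int (m i) + 1) * 2 powi (- n)} | m :: 'd \<Rightarrow> int. True}"

definition dyadic_cubes :: "real ^ 'd \<Rightarrow> (real ^ 'd) set set" where
  "dyadic_cubes P = (\<Union>n. dyadic_cubes_level P n)"

definition dyadic_boundary :: "real ^ 'd \<Rightarrow> (real ^ 'd) set" where
  "dyadic_boundary P = (\<Union>n. \<Union>D\<in>dyadic_cubes_level P n. frontier D)"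

definition dyadic_hull :: "real ^ 'd \<Rightarrow> real ^ 'd \<Rightarrow> real ^ 'd \<Rightarrow> (real ^ 'd) set" where
  "dyadic_hull P x y =
     (if x = y then {}
      else (THE Q. Q \<in> dyadic_cubes P \<union> {UNIV} \<and> x \<in> Q \<and> y \<in> Q \<and>
                   (\<forall>Q'\<in>dyadic_cubes P \<union> {UNIV}. x \<in> Q' \<longrightarrow> y \<in> Q' \<longrightarrow> Q' \<subseteq> Q \<longrightarrow> Q' = Q)))"

section \<open>Dyadic contents, large intersection classes and energies\<close>

definition dyadic_content ::
    "real ^ 'd \<Rightarrow> (real ^ 'd) measure \<Rightarrow> real \<Rightarrow> (real ^ 'd) set \<Rightarrow> ennreal" where
  "dyadic_content P \<mu> \<theta> E =
     (INF \<C>\<in>{\<C>. \<C> \<subseteq> dyadic_cubes P \<and> countable \<C> \<and> E \<subseteq> \<Union>\<C>}.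
        \<Sum>\<^sub>\<infinity>D\<in>\<C>. ennreal_powr (emeasure \<mu> D) \<theta>)"

definition large_intersection_class ::
    "real ^ 'd \<Rightarrow> (real ^ 'd) measure \<Rightarrow> real \<Rightarrow> (real ^ 'd) set set" where
  "large_intersection_class P \<mu> \<theta> =
     {E. gdelta E \<and>
         (\<forall>\<eta>. 0 < \<eta> \<longrightarrow> \<eta> < \<theta> \<longrightarrow>
            (\<forall>D\<in>dyadic_cubes P. dyadic_content P \<mu> \<eta> (E \<inter> D) = dyadic_content P \<mu> \<eta> D))}"

definition dyadic_energy ::
    "real ^ 'd \<Rightarrow> (real ^ 'd) measure \<Rightarrow> real \<Rightarrow> (real ^ 'd) measure \<Rightarrow> ennreal" where
  "dyadic_energy P \<mu> \<eta> \<nu> =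
     (\<integral>\<^sup>+ x. \<integral>\<^sup>+ y. ennreal_powr (emeasure \<mu> (dyadic_hull P x y)) (- \<eta>) \<partial>\<nu> \<partial>\<nu>)"

end

theory Submission
  imports Defs
begin

text \<open>
  For a dyadic cube \<open>D\<close> and \<open>0 < \<eta> < \<theta>\<close>, covering by \<open>{D}\<close> alone gives
  \<open>M\<^sup>\<eta>(D) \<le> \<mu>(D)\<^sup>\<eta>\<close>, so it is enough to show that every dyadic cover of
  \<open>limsup E\<^sub>n \<inter> D\<close> has cost (sum of the \<open>\<mu>(C)\<^sup>\<eta>\<close>) at least \<open>\<mu>(D)\<^sup>\<eta>\<close>. Call a set
  dyadically full if it has this property for all \<open>D\<close>. Two facts carry the proof.

  The first is that each tail union \<open>G\<^sub>k = \<Union>\<^sub>n\<^sub>\<ge>\<^sub>k E\<^sub>n\<close> is full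
  (\<open>dyadically_full_of_bounded_energy\<close>). Let \<open>\<M>\<close> be the maximal cubes, among those
  that meet \<open>D\<close>, of a cover of \<open>G\<^sub>k \<inter> D\<close> of finite cost; they are disjoint, and unless one of them contains \<open>D\<close> they lie in \<open>D\<close>. As \<open>\<mu>\<^sub>n\<close>
  lives on \<open>G\<^sub>k\<close> for \<open>n \<ge> k\<close>, \<open>\<mu>\<^sub>n(D)\<close> is at most the sum of the \<open>\<mu>\<^sub>n(C)\<close> over \<open>C \<in> \<M>\<close>. Fix
  \<open>\<eta> < \<eta>' < \<theta>\<close>. Two points of \<open>C\<close> have their hull inside \<open>C\<close>, so the energy of exponent
  \<open>\<eta>'\<close> dominates the sum of the \<open>\<mu>\<^sub>n(C)\<^sup>2 * \<mu>(C) powr (-\<eta>')\<close>, and this makes the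
  contribution of the cubes with \<open>\<mu>(C) < t\<close> small uniformly in \<open>n\<close> as \<open>t\<close> tends to 0. Only
  finitely many cubes are left, and on each of them \<open>\<mu>\<^sub>n(C)\<close> converges to \<open>\<mu>(C)\<close>, because
  \<open>\<mu>\<close> does not charge boundaries of dyadic cubes. In the limit \<open>\<mu>(D)\<close> is at most the sum of the
  \<open>\<mu>(C) \<le> \<mu>(D) powr (1-\<eta>) * \<mu>(C) powr \<eta>\<close>, and division by \<open>\<mu>(D) powr (1-\<eta>)\<close> bounds the
  cost from below by \<open>\<mu>(D) powr \<eta>\<close>.

  The second is that a countable intersection of full open sets is full
  (\<open>dyadically_full_INT\<close>), a Baire category argument. If a cover is too cheap for a cube, it is
  too cheap for some strictly smaller cube whose closure lies in the first cube and in the next open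
  set. The resulting nested cubes meet in a point of the intersection that no member of the cover
  can contain.
\<close>

section \<open>Dyadic cubes\<close>

text \<open>
  The cube of side \<open>2 powi (- n)\<close> that contains \<open>x\<close>. Comparing integer parts, rather than
  coordinates with end points, turns the nesting of cubes into integer division by powers of two.
\<close>

definition dyadic_cube_at :: "real ^ 'd \<Rightarrow> int \<Rightarrow> real ^ 'd \<Rightarrow> (real ^ 'd) set" where
  "dyadic_cube_at P n x =
     {y. \<forall>i. \<lfloor>(y $ i - P $ i) * 2 powi n\<rfloor> = \<lfloor>(x $ i - P $ i) * 2 powi n\<rfloor>}"

lemma floor_scaled_eq_iff:
  fixes a p :: real
  shows "\<lfloor>(a - p) * 2 powi n\<rfloor> = m \<longleftrightarrow>
    p + of_int m * 2 powi (- n) \<le> a \<and> a < p + (of_int m + 1) * 2 powi (- n)"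
proof -
  have pos: "(0::real) < 2 powi n" by simp
  have inv: "(2::real) powi (- n) = 1 / 2 powi n"
    by (simp add: power_int_minus field_simps)
  show ?thesis
    unfolding floor_eq_iff inv using pos by (auto simp: field_simps)
qed

lemma dyadic_cubes_level_eq: "dyadic_cubes_level P n = range (dyadic_cube_at P n)"
proof -
  have eq: "{x. \<forall>i. P $ i + of_int (m i) * 2 powi (- n) \<le> x $ i \<and>
      x $ i < P $ i + (of_int (m i) + 1) * 2 powi (- n)}
    = {x. \<forall>i. \<lfloor>(x $ i - P $ i) * 2 powi n\<rfloor> = m i}" for m :: "'a \<Rightarrow> int"
    by (simp only: floor_scaled_eq_iff)
  have "{x. \<forall>i. \<lfloor>(x $ i - P $ i) * 2 powi n\<rfloor> = m i} \<in> range (dyadic_cube_at P n)" for m :: "'a \<Rightarrow> int"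
  proof -
    define x :: "real ^ 'a" where "x = (\<chi> i. P $ i + of_int (m i) * 2 powi (- n))"
    have "\<lfloor>(x $ i - P $ i) * 2 powi n\<rfloor> = m i" for i
      unfolding floor_scaled_eq_iff x_def by (simp add: algebra_simps)
    then have "dyadic_cube_at P n x = {x. \<forall>i. \<lfloor>(x $ i - P $ i) * 2 powi n\<rfloor> = m i}"
      by (simp add: dyadic_cube_at_def)
    then show ?thesis by (metis rangeI)
  qed
  then show ?thesis
    unfolding dyadic_cubes_level_def eq by (auto simp: dyadic_cube_at_def)
qed

lemma dyadic_cubes_iff: "Q \<in> dyadic_cubes P \<longleftrightarrow> (\<exists>n x. Q = dyadic_cube_at P n x)"
  by (auto simp: dyadic_cubes_def dyadic_cubes_level_eq)

lemma dyadic_cube_at_self: "x \<in> dyadic_cube_at P n x"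
  by (simp add: dyadic_cube_at_def)

lemma dyadic_cube_at_cong: "y \<in> dyadic_cube_at P n x \<Longrightarrow> dyadic_cube_at P n x = dyadic_cube_at P n y"
  by (simp add: dyadic_cube_at_def)

lemma dyadic_cubeE:
  assumes "Q \<in> dyadic_cubes P" "x \<in> Q"
  obtains n where "Q = dyadic_cube_at P n x"
  using assms dyadic_cube_at_cong unfolding dyadic_cubes_iff by blast

lemma dyadic_cube_nonempty: "Q \<in> dyadic_cubes P \<Longrightarrow> Q \<noteq> {}"
  using dyadic_cube_at_self unfolding dyadic_cubes_iff by blast

lemma dyadic_cube_at_mono:
  assumes "n \<le> m"
  shows "dyadic_cube_at P m x \<subseteq> dyadic_cube_at P n x"
proof -
  define k where "k = nat (m - n)"
  have "(2::real) powi m = 2 powi n * 2 ^ k"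
    using assms power_int_add[of "2::real" n "m - n"] by (simp add: k_def power_int_def)
  \<comment> \<open>The index at the coarser level is that at the finer level divided by \<open>2 ^ k\<close>.\<close>
  then have "\<lfloor>(y $ i - P $ i) * 2 powi n\<rfloor> = \<lfloor>(y $ i - P $ i) * 2 powi m\<rfloor> div 2 ^ k" for y :: "real ^ 'a" and i
    using floor_divide_real_eq_div[of "2 ^ k" "(y $ i - P $ i) * 2 powi m"] by simp
  then show ?thesis by (auto simp: dyadic_cube_at_def)
qed

lemma dyadic_cubes_nested:
  assumes "A \<in> dyadic_cubes P" "B \<in> dyadic_cubes P" "A \<inter> B \<noteq> {}"
  shows "A \<subseteq> B \<or> B \<subseteq> A"
proof -
  obtain x where x: "x \<in> A" "x \<in> B" using assms(3) by blast
  obtain n m where "A = dyadic_cube_at P n x" "B = dyadic_cube_at P m x"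
    using x assms(1,2) by (meson dyadic_cubeE)
  then show ?thesis using dyadic_cube_at_mono linear by metis
qed

lemma dyadic_cube_at_dist:
  assumes "y \<in> dyadic_cube_at P n x"
  shows "\<bar>y $ i - x $ i\<bar> < 2 powi (- n)"
proof -
  define m where "m = \<lfloor>(x $ i - P $ i) * 2 powi n\<rfloor>"
  have "\<lfloor>(y $ i - P $ i) * 2 powi n\<rfloor> = m" "\<lfloor>(x $ i - P $ i) * 2 powi n\<rfloor> = m"
    using assms by (auto simp: dyadic_cube_at_def m_def)
  then show ?thesis unfolding floor_scaled_eq_iff by (auto simp: algebra_simps)
qed

lemma two_powi_small:
  assumes "(0::real) < e"
  obtains m where "n \<le> m" "2 powi (- m) < e"
proof -
  obtain k where k: "(1/2::real) ^ k < e"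
    using assms real_arch_pow_inv[of e "1/2"] by auto
  define m where "m = max n (int k)"
  have "(2::real) powi (- m) \<le> 2 powi (- int k)"
    by (intro power_int_increasing) (auto simp: m_def)
  also have "\<dots> = (1/2) ^ k"
    by (simp add: power_int_minus power_one_over inverse_eq_divide)
  finally show ?thesis using k that[of m] by (simp add: m_def)
qed

text \<open>
  A coarser cube does not fit into a finer one: its lowest corner and the point half a side above
  that corner are too far apart. Hence the level of a cube is determined by its set of points.
\<close>

lemma dyadic_cube_at_subset_level:
  assumes "dyadic_cube_at P m x \<subseteq> dyadic_cube_at P n y"
  shows "n \<le> m"
proof (rule ccontr)
  assume "\<not> n \<le> m"
  then have lt: "m < n" by simp
  define l where "l = (\<chi> i. P $ i + of_int \<lfloor>(x $ i - P $ i) * 2 powi m\<rfloor> * 2 powi (- m))"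
  define u where "u = (\<chi> i. l $ i + (2 powi (- m)) / 2)"
  have "\<lfloor>(l $ i - P $ i) * 2 powi m\<rfloor> = \<lfloor>(x $ i - P $ i) * 2 powi m\<rfloor>" for i
    unfolding floor_scaled_eq_iff l_def by (simp add: algebra_simps)
  then have l: "l \<in> dyadic_cube_at P m x" by (simp add: dyadic_cube_at_def)
  have "\<lfloor>(u $ i - P $ i) * 2 powi m\<rfloor> = \<lfloor>(x $ i - P $ i) * 2 powi m\<rfloor>" for i
    unfolding floor_scaled_eq_iff u_def l_def by (simp add: algebra_simps)
  then have u: "u \<in> dyadic_cube_at P m x" by (simp add: dyadic_cube_at_def)
  have "u \<in> dyadic_cube_at P n l"
    using l u assms dyadic_cube_at_cong by blast
  then have "(2::real) powi (- m) / 2 < 2 powi (- n)"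
    using dyadic_cube_at_dist[of u P n l] by (simp add: u_def)
  moreover have "(2::real) powi (- n) \<le> 2 powi (- m - 1)"
    using lt by (intro power_int_increasing) auto
  moreover have "(2::real) powi (- m - 1) = 2 powi (- m) / 2"
    by (simp add: power_int_diff)
  ultimately show False by simp
qed

text \<open>
  The distance of two distinct points bounds the levels of the cubes containing both from above,
  and the level of \<open>D\<close> bounds them from below. This finiteness yields all maximal and minimal cubes
  below, and the contradiction at the end of the nested-cubes argument.
\<close>

lemma finite_dyadic_cubes_between:
  assumes "x \<noteq> y" "D \<in> dyadic_cubes P"
  shows "finite {Q \<in> dyadic_cubes P. x \<in> Q \<and> y \<in> Q \<and> Q \<subseteq> D}"
proof -
  obtain i where i: "x $ i \<noteq> y $ i" using assms(1) by (metis vec_eq_iff)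
  obtain d z where D: "D = dyadic_cube_at P d z" using assms(2) dyadic_cubes_iff by blast
  obtain M where M: "(2::real) powi (- M) < \<bar>y $ i - x $ i\<bar>"
    using two_powi_small[of "\<bar>y $ i - x $ i\<bar>" 0] i by auto
  have "{Q \<in> dyadic_cubes P. x \<in> Q \<and> y \<in> Q \<and> Q \<subseteq> D} \<subseteq> (\<lambda>n. dyadic_cube_at P n x) ` {d..M}"
  proof
    fix Q assume "Q \<in> {Q \<in> dyadic_cubes P. x \<in> Q \<and> y \<in> Q \<and> Q \<subseteq> D}"
    then have Q: "Q \<in> dyadic_cubes P" "x \<in> Q" "y \<in> Q" "Q \<subseteq> D" by auto
    then obtain n where n: "Q = dyadic_cube_at P n x" by (meson dyadic_cubeE)
    have "d \<le> n" using Q(4) D n dyadic_cube_at_subset_level by blast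
    moreover have "n \<le> M"
    proof (rule ccontr)
      assume "\<not> n \<le> M"
      then have "(2::real) powi (- n) \<le> 2 powi (- M)"
        by (intro power_int_increasing) auto
      with M dyadic_cube_at_dist[of y P n x i] Q(3) n show False by simp
    qed
    ultimately show "Q \<in> (\<lambda>n. dyadic_cube_at P n x) ` {d..M}" using n by auto
  qed
  then show ?thesis by (meson finite_atLeastAtMost_int finite_imageI finite_subset)
qed

text \<open>
  Only the upper faces are missing from a half-open cube, and they are cut off by the open
  conditions on the upper end points.
\<close>

lemma dyadic_cube_eq_closure_Int_open:
  assumes "Q \<in> dyadic_cubes P"
  obtains V where "open V" "Q = closure Q \<inter> V"
proof -
  obtain n z where Q: "Q = dyadic_cube_at P n z" using assms dyadic_cubes_iff by blast
  define m where "m i = \<lfloor>(z $ i - P $ i) * 2 powi n\<rfloor>" for i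
  define l where "l i = P $ i + of_int (m i) * 2 powi (- n)" for i
  define u where "u i = P $ i + (of_int (m i) + 1) * 2 powi (- n)" for i
  have Qeq: "Q = {x. \<forall>i. l i \<le> x $ i \<and> x $ i < u i}"
    by (simp add: Q dyadic_cube_at_def floor_scaled_eq_iff l_def u_def m_def)
  define V where "V = {x. \<forall>i. x $ i < u i}"
  define L where "L = {x. \<forall>i. l i \<le> x $ i}"
  have "open V" unfolding V_def Collect_all_eq by (intro open_INT ballI open_Collect_less continuous_intros) simp
  have "closed L" unfolding L_def by (intro closed_Collect_all closed_Collect_le continuous_intros)
  then have "closure Q \<subseteq> L" by (intro closure_minimal) (auto simp: Qeq L_def)
  then have "Q = closure Q \<inter> V"
    using closure_subset[of Q] by (auto simp: Qeq L_def V_def)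
  with \<open>open V\<close> show ?thesis by (rule that)
qed

lemma borel_dyadic_cube: "Q \<in> dyadic_cubes P \<Longrightarrow> Q \<in> sets borel"
  by (metis borel_closed borel_open closed_closure dyadic_cube_eq_closure_Int_open sets.Int)

lemma dyadic_cube_at_closure_bound:
  fixes x :: "real ^ 'd"
  assumes "y \<in> closure (dyadic_cube_at P n x)"
  shows "dist y x \<le> real CARD('d) * 2 powi (- n)"
proof -
  have "dist y x \<le> real CARD('d) * 2 powi (- n)" if "y \<in> dyadic_cube_at P n x" for y
  proof -
    have "norm (y - x) \<le> (\<Sum>i\<in>UNIV. \<bar>(y - x) $ i\<bar>)" by (rule norm_le_l1_cart)
    also have "\<dots> \<le> (\<Sum>i\<in>(UNIV::'d set). 2 powi (- n))"
      using dyadic_cube_at_dist[OF that] by (intro sum_mono) (simp add: less_imp_le)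
    finally show ?thesis by (simp add: dist_norm)
  qed
  then have "dyadic_cube_at P n x \<subseteq> cball x (real CARD('d) * 2 powi (- n))"
    by (auto simp: dist_commute)
  then have "closure (dyadic_cube_at P n x) \<subseteq> cball x (real CARD('d) * 2 powi (- n))"
    by (intro closure_minimal) auto
  with assms show ?thesis by (auto simp: dist_commute)
qed

lemma bounded_dyadic_cube: "Q \<in> dyadic_cubes P \<Longrightarrow> bounded Q"
proof -
  assume "Q \<in> dyadic_cubes P"
  then obtain n x where "Q = dyadic_cube_at P n x" using dyadic_cubes_iff by blast
  then show ?thesis
    using dyadic_cube_at_closure_bound[of _ P n x] closure_subset[of Q]
    unfolding bounded_def by (metis dist_commute subset_iff)
qed

text \<open>
  Points on a lower face of \<open>Q\<close> cause no difficulty: a small cube around such a point has its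
  closure inside the closure of \<open>Q\<close> and away from the upper faces, hence inside \<open>Q\<close>.
\<close>

lemma dyadic_cube_refine:
  assumes Q: "Q \<in> dyadic_cubes P" and U: "open U" and x: "x \<in> Q" "x \<in> U"
  obtains W where "W \<in> dyadic_cubes P" "x \<in> W" "W \<noteq> Q" "closure W \<subseteq> Q \<inter> U"
proof -
  obtain V where V: "open V" "Q = closure Q \<inter> V" using Q by (rule dyadic_cube_eq_closure_Int_open)
  obtain n where n: "Q = dyadic_cube_at P n x" using Q x(1) by (rule dyadic_cubeE)
  obtain e where e: "0 < e" "ball x e \<subseteq> U \<inter> V"
    using open_contains_ball[of "U \<inter> V"] U V x by blast
  obtain m where m: "n + 1 \<le> m" "(2::real) powi (- m) < e / real CARD('a)"
    using two_powi_small[of "e / real CARD('a)" "n + 1"] e(1) by auto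
  have "closure (dyadic_cube_at P m x) \<subseteq> ball x e"
  proof
    fix y assume "y \<in> closure (dyadic_cube_at P m x)"
    then have "dist y x \<le> real CARD('a) * 2 powi (- m)" by (rule dyadic_cube_at_closure_bound)
    also have "\<dots> < e" using m(2) by (simp add: field_simps)
    finally show "y \<in> ball x e" by (simp add: dist_commute)
  qed
  moreover have "closure (dyadic_cube_at P m x) \<subseteq> closure Q"
    using dyadic_cube_at_mono[of n m P x] m(1) n by (simp add: closure_mono)
  moreover have "dyadic_cube_at P m x \<noteq> Q"
    using dyadic_cube_at_subset_level[of P n x m x] m(1) n by auto
  ultimately have "closure (dyadic_cube_at P m x) \<subseteq> Q \<inter> U" "dyadic_cube_at P m x \<noteq> Q"
    using V(2) e(2) by blast+
  then show ?thesis
    by (intro that[of "dyadic_cube_at P m x"]) (auto simp: dyadic_cube_at_self dyadic_cubes_iff)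
qed

lemma two_points_in_dyadic_cube:
  assumes "Q \<in> dyadic_cubes P"
  obtains x y where "x \<in> Q" "y \<in> Q" "x \<noteq> y"
proof -
  obtain n x where Q: "Q = dyadic_cube_at P n x" using assms dyadic_cubes_iff by blast
  have "Q \<noteq> {x}"
  proof
    assume "Q = {x}"
    moreover have "x \<in> dyadic_cube_at P (n+1) x" by (rule dyadic_cube_at_self)
    ultimately have "dyadic_cube_at P n x \<subseteq> dyadic_cube_at P (n+1) x" using Q by simp
    from dyadic_cube_at_subset_level[OF this] show False by simp
  qed
  moreover have "x \<in> Q" by (simp add: Q dyadic_cube_at_self)
  ultimately show ?thesis using that by blast
qed

lemma finite_dyadic_cubes_supset:
  assumes "C \<in> dyadic_cubes P" "D \<in> dyadic_cubes P"
  shows "finite {Q \<in> dyadic_cubes P. C \<subseteq> Q \<and> Q \<subseteq> D}"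
proof -
  obtain x y where "x \<in> C" "y \<in> C" "x \<noteq> y" using two_points_in_dyadic_cube assms(1) by blast
  then show ?thesis
    by (intro finite_subset[OF _ finite_dyadic_cubes_between[of x y D P]]) (use assms in auto)
qed

definition maximal_members :: "'a set set \<Rightarrow> 'a set set" where
  "maximal_members \<F> = {A \<in> \<F>. \<forall>B\<in>\<F>. A \<subseteq> B \<longrightarrow> A = B}"

lemma maximal_dyadic_cube_above:
  assumes \<F>: "\<F> \<subseteq> dyadic_cubes P" and D: "D \<in> dyadic_cubes P" "\<And>A. A \<in> \<F> \<Longrightarrow> A \<subseteq> D"
    and C: "C \<in> \<F>"
  obtains M where "M \<in> maximal_members \<F>" "C \<subseteq> M"
proof -
  define \<G> where "\<G> = {Q \<in> \<F>. C \<subseteq> Q}"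
  have fin: "finite \<G>"
    by (rule finite_subset[OF _ finite_dyadic_cubes_supset[of C P D]]) (use assms in \<open>auto simp: \<G>_def\<close>)
  have "\<G> \<noteq> {}" using C by (auto simp: \<G>_def)
  with fin obtain M where M: "M \<in> \<G>" "\<And>B. B \<in> \<G> \<Longrightarrow> M \<subseteq> B \<Longrightarrow> M = B"
    using finite_has_maximal[of \<G>] by (metis)
  then show ?thesis by (intro that[of M]) (auto simp: \<G>_def maximal_members_def)
qed

lemma maximal_members_disjoint:
  assumes "\<F> \<subseteq> dyadic_cubes P" "A \<in> maximal_members \<F>" "B \<in> maximal_members \<F>" "A \<inter> B \<noteq> {}"
  shows "A = B"
  using dyadic_cubes_nested[of A P B] assms by (auto simp: maximal_members_def)

lemma countable_dyadic_family:
  assumes "\<F> \<subseteq> dyadic_cubes P"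
  shows "countable \<F>"
proof -
  have lev: "countable (dyadic_cubes_level P n)" for n
  proof -
    define g where "g m = {x. \<forall>i. P $ i + of_int (m i) * 2 powi (- n) \<le> x $ i \<and>
        x $ i < P $ i + (of_int (m i) + 1) * 2 powi (- n)}" for m :: "'a \<Rightarrow> int"
    have "countable (UNIV :: ('a \<Rightarrow> int) set)" 
      by simp
    then have "countable (range g)" by simp
    moreover have "dyadic_cubes_level P n = range g" unfolding dyadic_cubes_level_def g_def by auto
    ultimately show ?thesis by simp
  qed
  then have "countable (dyadic_cubes P)" by (simp add: dyadic_cubes_def)
  then show ?thesis using assms countable_subset by blast
qed

text \<open>
  The minimal cube defining the hull exists because only finitely many cubes inside \<open>D\<close> contain
  both points, and it is unique because cubes with a common point are nested.
\<close>

lemma dyadic_hull_subset: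
  assumes D: "D \<in> dyadic_cubes P" "x \<in> D" "y \<in> D"
  shows "dyadic_hull P x y \<subseteq> D"
proof (cases "x = y")
  case True
  then show ?thesis by (simp add: dyadic_hull_def)
next
  case False
  define \<G> where "\<G> = {Q \<in> dyadic_cubes P. x \<in> Q \<and> y \<in> Q \<and> Q \<subseteq> D}"
  have "finite \<G>" unfolding \<G>_def using False D(1) by (rule finite_dyadic_cubes_between)
  moreover have "\<G> \<noteq> {}" using D by (auto simp: \<G>_def)
  ultimately obtain M where M: "M \<in> \<G>" "\<And>B. B \<in> \<G> \<Longrightarrow> B \<subseteq> M \<Longrightarrow> M = B"
    using finite_has_minimal[of \<G>] by metis
  have nested: "A \<subseteq> B \<or> B \<subseteq> A" if "A \<in> dyadic_cubes P \<union> {UNIV}" "B \<in> dyadic_cubes P \<union> {UNIV}" "x \<in> A" "x \<in> B" for A B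
    using dyadic_cubes_nested[of A P B] that by blast
  have "(THE Q. Q \<in> dyadic_cubes P \<union> {UNIV} \<and> x \<in> Q \<and> y \<in> Q \<and>
      (\<forall>Q'\<in>dyadic_cubes P \<union> {UNIV}. x \<in> Q' \<longrightarrow> y \<in> Q' \<longrightarrow> Q' \<subseteq> Q \<longrightarrow> Q' = Q)) = M"
  proof (rule the_equality)
    have MD: "M \<in> dyadic_cubes P" "x \<in> M" "y \<in> M" "M \<subseteq> D" using M(1) by (auto simp: \<G>_def)
    then show m: "M \<in> dyadic_cubes P \<union> {UNIV} \<and> x \<in> M \<and> y \<in> M \<and>
      (\<forall>Q'\<in>dyadic_cubes P \<union> {UNIV}. x \<in> Q' \<longrightarrow> y \<in> Q' \<longrightarrow> Q' \<subseteq> M \<longrightarrow> Q' = M)"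
      using M(2) unfolding \<G>_def by auto
    fix Q assume Q: "Q \<in> dyadic_cubes P \<union> {UNIV} \<and> x \<in> Q \<and> y \<in> Q \<and>
      (\<forall>Q'\<in>dyadic_cubes P \<union> {UNIV}. x \<in> Q' \<longrightarrow> y \<in> Q' \<longrightarrow> Q' \<subseteq> Q \<longrightarrow> Q' = Q)"
    then show "Q = M" using m nested[of Q M] by metis
  qed
  then show ?thesis using False M(1) by (simp add: dyadic_hull_def \<G>_def)
qed

section \<open>Powers and sums in the extended nonnegative reals\<close>

lemma ennreal_powr_ennreal: "0 < b \<Longrightarrow> ennreal_powr (ennreal b) a = ennreal (b powr a)"
  by (simp add: ennreal_powr_def)

lemma ennreal_powr_mono:
  assumes "0 < a" "x \<le> y"
  shows "ennreal_powr x a \<le> ennreal_powr y a"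
proof (cases "x = 0 \<or> y = \<infinity>")
  case True
  then show ?thesis using assms by (auto simp: ennreal_powr_def)
next
  case False
  then have "x \<noteq> \<infinity>" "y \<noteq> 0" using assms by (auto simp: top_unique)
  then obtain r s where rs: "x = ennreal r" "y = ennreal s" "0 < r" "0 < s"
    using False by (cases x; cases y) auto
  then have "r \<le> s" using assms by simp
  then show ?thesis using rs assms by (auto simp: ennreal_powr_ennreal intro!: ennreal_leI powr_mono2)
qed

lemma ennreal_powr_antimono:
  assumes "a < 0" "x \<le> y"
  shows "ennreal_powr y a \<le> ennreal_powr x a"
proof (cases "x = 0 \<or> y = \<infinity>")
  case True
  then show ?thesis using assms by (auto simp: ennreal_powr_def)
next
  case False
  then have "x \<noteq> \<infinity>" "y \<noteq> 0" using assms by (auto simp: top_unique)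
  then obtain r s where rs: "x = ennreal r" "y = ennreal s" "0 < r" "0 < s"
    using False by (cases x; cases y) auto
  then have "r \<le> s" using assms by simp
  then show ?thesis using rs assms by (auto simp: ennreal_powr_ennreal intro!: ennreal_leI powr_mono2')
qed

text \<open>
  Here \<open>a\<close> and \<open>b\<close> stand for \<open>\<mu>\<^sub>n(C)\<close> and \<open>\<mu>(C)\<close>, and the two terms on the right sum to the cost
  of the cover and to the energy. If the first term does not dominate, then \<open>a > \<delta> b\<^sup>\<eta>\<close>, and
  multiplying \<open>a\<close> by \<open>a / (\<delta> b\<^sup>\<eta>)\<close>, which exceeds 1, gives the second; the gain \<open>t powr (\<eta>' - \<eta>)\<close>
  comes from the gap between the two exponents. For \<open>b = 0\<close> the negative power is infinite.
\<close>

lemma small_cube_estimate: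
  fixes a b t \<delta> \<eta> \<eta>' :: real
  assumes "0 \<le> a" "0 \<le> b" "b < t" "0 < \<delta>" "0 < \<eta>" "\<eta> < \<eta>'"
  shows "ennreal a \<le> ennreal \<delta> * ennreal_powr (ennreal b) \<eta>
    + ennreal (t powr (\<eta>' - \<eta>) / \<delta>) * (ennreal a * ennreal a * ennreal_powr (ennreal b) (- \<eta>'))"
proof -
  consider "a = 0" | "a > 0" "b = 0" | "a > 0" "b > 0" using assms by linarith
  then show ?thesis
  proof cases
    case 1
    then show ?thesis by simp
  next
    case 2
    then show ?thesis using assms by (simp add: ennreal_powr_def ennreal_mult_top ennreal_mult_eq_top_iff)
  next
    case 3
    have "a \<le> \<delta> * b powr \<eta> + (t powr (\<eta>' - \<eta>) / \<delta>) * (a * a * b powr (- \<eta>'))"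
    proof (cases "a \<le> \<delta> * b powr \<eta>")
      case True
      then show ?thesis using assms by (simp add: add_increasing2)
    next
      case False
      have "a * (\<delta> * b powr \<eta>) \<le> a * a" using False 3 by (intro mult_left_mono) auto
      also have "\<dots> \<le> a * a * (t powr (\<eta>' - \<eta>) * b powr (\<eta> - \<eta>'))"
      proof -
        have "1 = b powr (\<eta>' - \<eta>) * b powr (\<eta> - \<eta>')" using 3 by (simp flip: powr_add)
        also have "\<dots> \<le> t powr (\<eta>' - \<eta>) * b powr (\<eta> - \<eta>')"
          using 3 assms by (intro mult_right_mono powr_mono2) auto
        finally show ?thesis using 3 by (simp add: mult_le_cancel_left1)
      qed
      also have "\<dots> = a * a * t powr (\<eta>' - \<eta>) * b powr (- \<eta>') * b powr \<eta>"
        using 3 by (simp add: powr_diff powr_minus field_simps)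
      finally have "(a * \<delta>) * b powr \<eta> \<le> (a * a * t powr (\<eta>' - \<eta>) * b powr (- \<eta>')) * b powr \<eta>"
        by (simp add: mult_ac)
      then have "a * \<delta> \<le> a * a * t powr (\<eta>' - \<eta>) * b powr (- \<eta>')"
        using 3 by (simp only: mult_le_cancel_right_pos powr_gt_zero)
      then have "a \<le> (t powr (\<eta>' - \<eta>) / \<delta>) * (a * a * b powr (- \<eta>'))"
        using assms(4) by (simp add: field_simps)
      moreover have "0 \<le> \<delta> * b powr \<eta>" using assms by simp
      ultimately show ?thesis by linarith
    qed
    then show ?thesis
      using 3 assms by (simp add: ennreal_powr_ennreal ennreal_leI flip: ennreal_mult ennreal_plus)
  qed
qed

lemma nn_integral_count_space_le_infsum:
  fixes f :: "'i \<Rightarrow> ennreal"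
  assumes "countable A"
  shows "(\<integral>\<^sup>+i. f i \<partial>count_space A) \<le> (\<Sum>\<^sub>\<infinity>i\<in>A. f i)"
proof -
  have fin: "sum f F \<le> (\<Sum>\<^sub>\<infinity>i\<in>A. f i)" if "finite F" "F \<subseteq> A" for F
    unfolding nonneg_infsum_complete[of A f, OF zero_le] using that by (intro SUP_upper) auto
  show ?thesis
  proof (cases "finite A")
    case True
    then show ?thesis using fin[of A] by (simp add: nn_integral_count_space_finite)
  next
    case False
    have bij: "bij_betw (from_nat_into A) UNIV A"
      using assms False by (rule bij_betw_from_nat_into)
    have "(\<integral>\<^sup>+i. f i \<partial>count_space A) = (\<Sum>n. f (from_nat_into A n))"
      using nn_integral_bij_count_space[OF bij, of f] by (simp add: nn_integral_count_space_nat)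
    also have "\<dots> \<le> (\<Sum>\<^sub>\<infinity>i\<in>A. f i)"
    proof (intro suminf_le_const summableI)
      fix n
      have inj: "inj_on (from_nat_into A) {..<n}"
        using bij by (meson bij_betw_imp_inj_on inj_on_subset subset_UNIV)
      have "(\<Sum>k<n. f (from_nat_into A k)) = sum f (from_nat_into A ` {..<n})"
        by (simp add: sum.reindex[OF inj])
      also have "\<dots> \<le> (\<Sum>\<^sub>\<infinity>i\<in>A. f i)"
        using bij by (intro fin) (auto simp: bij_betw_def)
      finally show "(\<Sum>k<n. f (from_nat_into A k)) \<le> (\<Sum>\<^sub>\<infinity>i\<in>A. f i)" .
    qed
    finally show ?thesis .
  qed
qed

section \<open>Supports and vague convergence\<close>

text \<open>
  The complement of the support is a union of open null sets, of which countably many suffice by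
  the Lindelof property.
\<close>

lemma complement_measure_support_null:
  fixes M :: "'a::second_countable_topology measure"
  assumes "sets M = sets borel"
  shows "- measure_support M \<in> null_sets M"
proof -
  define \<U> where "\<U> = {U. open U \<and> emeasure M U = 0}"
  have eq: "- measure_support M = \<Union>\<U>"
    by (auto simp: measure_support_def \<U>_def)
  obtain \<V> where \<V>: "\<V> \<subseteq> \<U>" "countable \<V>" "\<Union>\<V> = \<Union>\<U>"
    using Lindelof[of \<U>] by (auto simp: \<U>_def)
  have "(\<Union>U\<in>\<V>. U) \<in> null_sets M"
    using \<V> assms by (intro null_sets_UN') (auto simp: \<U>_def null_sets_def)
  then show ?thesis using eq \<V> by simp
qed

text \<open>
  The portmanteau argument for vague convergence: boundedness of \<open>A\<close> lets its indicator be squeezed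
  between continuous functions of compact support whose \<open>M\<close>-integrals approach the measures of the
  interior and of the closure of \<open>A\<close>, and these agree as the frontier is null. Finiteness of the
  measures of \<open>A\<close> comes from the integrability of the upper function.
\<close>

lemma weak_convergence_bounded_continuity_set:
  fixes Ms :: "nat \<Rightarrow> ('a::euclidean_space) measure"
  assumes conv: "weakly_converges Ms M"
    and sM: "sets M = sets borel" and sMs: "\<And>n. sets (Ms n) = sets borel"
    and A: "A \<in> sets borel" "bounded A" and null: "emeasure M (frontier A) = 0"
  shows "emeasure M A < \<infinity>" "\<And>n. emeasure (Ms n) A < \<infinity>"
    "(\<lambda>n. measure (Ms n) A) \<longlonglongrightarrow> measure M A"
proof -
  have "emeasure M A < \<infinity> \<and> (\<forall>n. emeasure (Ms n) A < \<infinity>) \<and>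
    (\<lambda>n. measure (Ms n) A) \<longlonglongrightarrow> measure M A"
  proof (cases "A = {}")
    case True
    then show ?thesis by simp
  next
    case False
    define K where "K = closure A"
    define O' where "O' = interior A"
    \<comment> \<open>\<open>f j\<close> decreases to the indicator of \<open>K\<close>, \<open>g j\<close> increases to that of \<open>O'\<close>.\<close>
    define f where "f j x = max 0 (1 - real (Suc j) * infdist x K)" for j x
    define g where "g j x = min 1 (real (Suc j) * infdist x (- O'))" for j x
    have K: "compact K" "K \<noteq> {}" "closed K" using A False by (auto simp: K_def compact_closure)
    have O: "open O'" "- O' \<noteq> {}" "closed (- O')" "O' \<subseteq> A"
    proof -
      show "open O'" "closed (- O')" "O' \<subseteq> A"
        by (auto simp: O'_def interior_subset closed_Compl)
      show "- O' \<noteq> {}"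
        using A(2) \<open>O' \<subseteq> A\<close> bounded_subset[of A O'] not_bounded_UNIV by (metis Compl_empty_eq double_complement)
    qed
    have AK: "A \<subseteq> K" by (simp add: K_def closure_subset)
    have f_K: "f j x = 1" if "x \<in> K" for j x using that by (simp add: f_def)
    have f_nn: "0 \<le> f j x" for j x by (simp add: f_def)
    have f_le: "f j x \<le> f 0 x" for j x
      unfolding f_def using infdist_nonneg[of x K]
      by (intro max.mono order_refl diff_left_mono mult_right_mono) auto
    have g_nn: "0 \<le> g j x" for j x
      using infdist_nonneg[of x "- O'"] by (simp add: g_def)
    have g_0: "g j x = 0" if "x \<notin> O'" for j x using that by (simp add: g_def)
    have g_1: "g j x \<le> 1" for j x by (simp add: g_def)
    have g_A: "g j x \<le> indicator A x" for j x
      using g_0[of x j] g_1[of j x] O(4) by (cases "x \<in> O'") (auto split: split_indicator)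
    have g_f: "g j x \<le> f 0 x" for j x
      using g_0[of x j] g_1[of j x] f_K[of x 0] f_nn[of 0 x] O(4) AK by (cases "x \<in> O'") auto
    have cf: "continuous_on UNIV (f j)" and cg: "continuous_on UNIV (g j)" for j
      unfolding f_def g_def by (intro continuous_intros)+
    have sf: "compact (closure {x. f j x \<noteq> 0})" for j
    proof -
      have "{x. f j x \<noteq> 0} \<subseteq> {x. infdist x K \<le> 1}"
      proof
        fix x assume "x \<in> {x. f j x \<noteq> 0}"
        then have "real (Suc j) * infdist x K < 1" by (auto simp: f_def max_def split: if_splits)
        moreover have "infdist x K \<le> real (Suc j) * infdist x K"
          using infdist_nonneg[of x K] by (simp add: algebra_simps)
        ultimately show "x \<in> {x. infdist x K \<le> 1}" by simp
      qed
      moreover have "bounded {x. infdist x K \<le> 1}"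
        using compact_infdist_le[of K 1] K compact_imp_bounded by auto
      ultimately show ?thesis using bounded_subset by (auto simp: compact_closure)
    qed
    have sg: "compact (closure {x. g j x \<noteq> 0})" for j
    proof -
      have "{x. g j x \<noteq> 0} \<subseteq> A" using g_0 O(4) by auto
      then show ?thesis using A(2) bounded_subset by (auto simp: compact_closure)
    qed
    have int_f: "integrable M (f j)" "integrable (Ms n) (f j)"
        "(\<lambda>n. integral\<^sup>L (Ms n) (f j)) \<longlonglongrightarrow> integral\<^sup>L M (f j)"
      and int_g: "integrable M (g j)" "integrable (Ms n) (g j)"
        "(\<lambda>n. integral\<^sup>L (Ms n) (g j)) \<longlonglongrightarrow> integral\<^sup>L M (g j)" for j n
      using conv cf[of j] sf[of j] cg[of j] sg[of j] unfolding weakly_converges_def by blast+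
    have KA: "K \<in> sets borel" "O' \<in> sets borel" using K O by auto
    have finK: "emeasure N K < \<infinity>" if N: "sets N = sets borel" "integrable N (f 0)" for N
    proof -
      have "emeasure N K = (\<integral>\<^sup>+x. indicator K x \<partial>N)" using KA N by simp
      also have "\<dots> \<le> (\<integral>\<^sup>+x. ennreal (f 0 x) \<partial>N)"
        by (intro nn_integral_mono) (auto simp: f_K split: split_indicator)
      also have "\<dots> < \<infinity>"
        using N(2) f_nn by (auto simp: integrable_iff_bounded)
      finally show ?thesis .
    qed
    have fin: "emeasure N A < \<infinity>" if "sets N = sets borel" "integrable N (f 0)" for N
      by (rule le_less_trans[OF emeasure_mono[OF AK] finK[OF that]]) (use KA that in simp)
    have iA: "integrable N (indicator A :: 'a \<Rightarrow> real)" "(\<integral>x. indicator A x \<partial>N) = measure N A"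
      if "sets N = sets borel" "integrable N (f 0)" for N
      using fin[OF that] A(1) that(1) sets_eq_imp_space_eq[OF that(1)] by auto
    have up: "measure N A \<le> integral\<^sup>L N (f j)"
      if "sets N = sets borel" "integrable N (f 0)" "integrable N (f j)" for N j
    proof -
      have "(\<integral>x. indicator A x \<partial>N) \<le> integral\<^sup>L N (f j)"
        using that iA[OF that(1,2)] AK f_K f_nn by (intro integral_mono) (auto split: split_indicator)
      then show ?thesis using iA[OF that(1,2)] by simp
    qed
    have lo: "integral\<^sup>L N (g j) \<le> measure N A"
      if "sets N = sets borel" "integrable N (f 0)" "integrable N (g j)" for N j
    proof -
      have "integral\<^sup>L N (g j) \<le> (\<integral>x. indicator A x \<partial>N)"
        using that iA[OF that(1,2)] g_A by (intro integral_mono) auto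
      then show ?thesis using iA[OF that(1,2)] by simp
    qed
    have sc: "filterlim (\<lambda>j. real (Suc j) * c) at_top sequentially" if "0 < c" for c :: real
      using that filterlim_tendsto_pos_mult_at_top[OF tendsto_const that, of "\<lambda>j. real (Suc j)" sequentially]
        filterlim_compose[OF filterlim_real_sequentially filterlim_Suc] by (simp add: mult.commute)
    have lim_f: "(\<lambda>j. f j x) \<longlonglongrightarrow> indicator K x" for x
    proof (cases "x \<in> K")
      case True then show ?thesis by (simp add: f_K)
    next
      case False
      then have pos: "0 < infdist x K"
        using K infdist_pos_not_in_closed by blast
      have "eventually (\<lambda>j. 1 \<le> real (Suc j) * infdist x K) sequentially"
        using sc[OF pos] by (simp add: filterlim_at_top)
      then have "eventually (\<lambda>j. f j x = indicator K x) sequentially"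
        by eventually_elim (use False in \<open>simp add: f_def\<close>)
      then show ?thesis by (rule tendsto_eventually)
    qed
    have lim_g: "(\<lambda>j. g j x) \<longlonglongrightarrow> indicator O' x" for x
    proof (cases "x \<in> O'")
      case False then show ?thesis by (simp add: g_0)
    next
      case True
      then have pos: "0 < infdist x (- O')"
        using O infdist_pos_not_in_closed[of "- O'" x] by blast
      have "eventually (\<lambda>j. 1 \<le> real (Suc j) * infdist x (- O')) sequentially"
        using sc[OF pos] by (simp add: filterlim_at_top)
      then have "eventually (\<lambda>j. g j x = indicator O' x) sequentially"
        by eventually_elim (use True in \<open>simp add: g_def\<close>)
      then show ?thesis by (rule tendsto_eventually)
    qed
    have meas: "f j \<in> borel_measurable M" "g j \<in> borel_measurable M" for j
      using int_f(1)[of j] int_g(1)[of j] by auto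
    have "(\<lambda>j. integral\<^sup>L M (f j)) \<longlonglongrightarrow> integral\<^sup>L M (indicator K)"
      by (rule integral_dominated_convergence[where w = "f 0"])
        (use lim_f meas int_f f_nn f_le KA sM in auto)
    moreover have "integral\<^sup>L M (indicator K) = measure M A"
    proof -
      have "measure M K = measure M A"
      proof (rule measure_eq_AE)
        have "frontier A \<in> null_sets M" using null sM by (simp add: null_sets_def)
        then have "AE x in M. x \<notin> frontier A" by (rule AE_not_in)
        then show "AE x in M. (x \<in> K) = (x \<in> A)"
          by eventually_elim (use AK interior_subset[of A] in \<open>auto simp: K_def frontier_def\<close>)
      qed (use KA A sM in auto)
      then show ?thesis using KA sM sets_eq_imp_space_eq[OF sM] by simp
    qed
    ultimately have Lf: "(\<lambda>j. integral\<^sup>L M (f j)) \<longlonglongrightarrow> measure M A" by simp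
    have "(\<lambda>j. integral\<^sup>L M (g j)) \<longlonglongrightarrow> integral\<^sup>L M (indicator O')"
      by (rule integral_dominated_convergence[where w = "f 0"])
        (use lim_g meas int_f g_nn g_f KA sM in auto)
    moreover have "integral\<^sup>L M (indicator O') = measure M A"
    proof -
      have "measure M O' = measure M A"
      proof (rule measure_eq_AE)
        have "frontier A \<in> null_sets M" using null sM by (simp add: null_sets_def)
        then have "AE x in M. x \<notin> frontier A" by (rule AE_not_in)
        then show "AE x in M. (x \<in> O') = (x \<in> A)"
          by eventually_elim (use AK O(4) in \<open>auto simp: K_def O'_def frontier_def\<close>)
      qed (use KA A sM in auto)
      then show ?thesis using KA sM sets_eq_imp_space_eq[OF sM] by simp
    qed
    ultimately have Lg: "(\<lambda>j. integral\<^sup>L M (g j)) \<longlonglongrightarrow> measure M A" by simp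
    have "(\<lambda>n. measure (Ms n) A) \<longlonglongrightarrow> measure M A"
    proof (rule order_tendstoI)
      fix y assume "y < measure M A"
      then obtain j where j: "y < integral\<^sup>L M (g j)"
        using order_tendstoD(1)[OF Lg] by (auto simp: eventually_sequentially)
      show "eventually (\<lambda>n. y < measure (Ms n) A) sequentially"
        using order_tendstoD(1)[OF int_g(3) j]
        by eventually_elim (rule less_le_trans[OF _ lo[OF sMs int_f(2) int_g(2)]])
    next
      fix y assume "measure M A < y"
      then obtain j where j: "integral\<^sup>L M (f j) < y"
        using order_tendstoD(2)[OF Lf] by (auto simp: eventually_sequentially)
      show "eventually (\<lambda>n. measure (Ms n) A < y) sequentially"
        using order_tendstoD(2)[OF int_f(3) j]
        by eventually_elim (rule le_less_trans[OF up[OF sMs int_f(2) int_f(2)]])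
    qed
    then show ?thesis using fin[OF sM int_f(1)] fin[OF sMs int_f(2)] by simp
  qed
  then show "emeasure M A < \<infinity>" "\<And>n. emeasure (Ms n) A < \<infinity>"
    "(\<lambda>n. measure (Ms n) A) \<longlonglongrightarrow> measure M A" by auto
qed

section \<open>The cost of a dyadic cover\<close>

definition cover_cost :: "(real ^ 'd) measure \<Rightarrow> real \<Rightarrow> (real ^ 'd) set set \<Rightarrow> ennreal" where
  "cover_cost \<mu> \<eta> \<C> = (\<integral>\<^sup>+C. ennreal_powr (emeasure \<mu> C) \<eta> \<partial>count_space \<C>)"

text \<open>
  This implies that \<open>U \<inter> D\<close> and \<open>D\<close> have the same content, because the cover of \<open>D\<close> by \<open>D\<close> alone
  bounds the content of \<open>D\<close> from above by the same number.
\<close>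

definition dyadically_full :: "real ^ 'd \<Rightarrow> (real ^ 'd) measure \<Rightarrow> real \<Rightarrow> (real ^ 'd) set \<Rightarrow> bool" where
  "dyadically_full P \<mu> \<eta> U \<longleftrightarrow>
     (\<forall>D\<in>dyadic_cubes P. \<forall>\<C>\<subseteq>dyadic_cubes P.
        U \<inter> D \<subseteq> \<Union>\<C> \<longrightarrow> ennreal_powr (emeasure \<mu> D) \<eta> \<le> cover_cost \<mu> \<eta> \<C>)"

text \<open>
  Read as a measure on the set of cubes, the cost inherits monotonicity, subadditivity and countable
  additivity over disjoint families of cubes.
\<close>

lemma cover_cost_eq_emeasure:
  "cover_cost \<mu> \<eta> \<C> = emeasure (density (count_space UNIV) (\<lambda>C. ennreal_powr (emeasure \<mu> C) \<eta>)) \<C>"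
proof (cases "\<C> = UNIV")
  case True
  then show ?thesis by (simp add: cover_cost_def emeasure_density)
next
  case False
  have "emeasure (density (count_space UNIV) (\<lambda>C. ennreal_powr (emeasure \<mu> C) \<eta>)) \<C>
    = (\<integral>\<^sup>+C. ennreal_powr (emeasure \<mu> C) \<eta> * indicator \<C> C \<partial>count_space UNIV)"
    by (simp add: emeasure_density)
  also have "\<dots> = cover_cost \<mu> \<eta> \<C>"
    unfolding cover_cost_def by (rule nn_integral_count_space_indicator[symmetric]) (simp add: NO_MATCH_def)
  finally show ?thesis by simp
qed

lemma cover_cost_mono: "\<C> \<subseteq> \<C>' \<Longrightarrow> cover_cost \<mu> \<eta> \<C> \<le> cover_cost \<mu> \<eta> \<C>'"
  unfolding cover_cost_eq_emeasure by (rule emeasure_mono) auto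

lemma cover_cost_finite: "finite \<C> \<Longrightarrow> cover_cost \<mu> \<eta> \<C> = (\<Sum>C\<in>\<C>. ennreal_powr (emeasure \<mu> C) \<eta>)"
  by (simp add: cover_cost_def nn_integral_count_space_finite)

lemma cover_cost_ge_member: "C \<in> \<C> \<Longrightarrow> ennreal_powr (emeasure \<mu> C) \<eta> \<le> cover_cost \<mu> \<eta> \<C>"
  using cover_cost_mono[of "{C}" \<C> \<mu> \<eta>] by (simp add: cover_cost_finite)

section \<open>Bounded energies force full cost\<close>

text \<open>
  For \<open>x\<close> and \<open>y\<close> in the same cube \<open>C\<close> the hull lies in \<open>C\<close>, so the integrand is at least
  \<open>\<mu>(C)\<close> to the power \<open>- \<eta>\<close>; the products \<open>C \<times> C\<close> are disjoint, so their contributions add up. On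
  the diagonal the bound holds by the convention that \<open>0\<close> to a negative power is infinite.
\<close>

lemma energy_ge_disjoint_cubes:
  assumes s\<nu>: "sets \<nu> = sets borel" and s\<mu>: "sets \<mu> = sets borel" and \<eta>: "0 < \<eta>"
    and \<C>: "\<C> \<subseteq> dyadic_cubes P" "\<And>A B. A \<in> \<C> \<Longrightarrow> B \<in> \<C> \<Longrightarrow> A \<inter> B \<noteq> {} \<Longrightarrow> A = B"
  shows "(\<integral>\<^sup>+C. emeasure \<nu> C * emeasure \<nu> C * ennreal_powr (emeasure \<mu> C) (- \<eta>) \<partial>count_space \<C>)
    \<le> dyadic_energy P \<mu> \<eta> \<nu>"
proof -
  define k where "k C = ennreal_powr (emeasure \<mu> C) (- \<eta>)" for C
  define h where "h x y = k (dyadic_hull P x y)" for x y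
  have meas: "C \<in> sets \<nu>" "C \<in> sets \<mu>" if "C \<in> \<C>" for C
    using that \<C>(1) borel_dyadic_cube s\<nu> s\<mu> by blast+
  have kh: "k C \<le> h x y" if "C \<in> \<C>" "x \<in> C" "y \<in> C" for C x y
    unfolding k_def h_def using that \<C>(1) meas \<eta>
    by (intro ennreal_powr_antimono emeasure_mono dyadic_hull_subset) auto
  have inner: "(\<integral>\<^sup>+C. (k C * emeasure \<nu> C) * indicator C x \<partial>count_space \<C>) \<le> (\<integral>\<^sup>+y. h x y \<partial>\<nu>)" for x
  proof (cases "\<exists>C\<in>\<C>. x \<in> C")
    case False
    then have "(\<integral>\<^sup>+C. (k C * emeasure \<nu> C) * indicator C x \<partial>count_space \<C>) = (\<integral>\<^sup>+C. 0 \<partial>count_space \<C>)"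
      by (intro nn_integral_cong) auto
    then show ?thesis by simp
  next
    case True
    then obtain C0 where C0: "C0 \<in> \<C>" "x \<in> C0" by blast
    have "(\<integral>\<^sup>+C. (k C * emeasure \<nu> C) * indicator C x \<partial>count_space \<C>)
      = (\<Sum>C\<in>{C0}. (k C * emeasure \<nu> C) * indicator C x)"
      by (rule nn_integral_count_space') (use C0 \<C>(2) in \<open>auto split: split_indicator\<close>)
    also have "\<dots> = k C0 * emeasure \<nu> C0" using C0 by simp
    also have "\<dots> = (\<integral>\<^sup>+y. k C0 * indicator C0 y \<partial>\<nu>)"
      using meas C0 by (simp add: nn_integral_cmult_indicator)
    also have "\<dots> \<le> (\<integral>\<^sup>+y. h x y \<partial>\<nu>)"
      using C0 kh by (intro nn_integral_mono) (auto split: split_indicator)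
    finally show ?thesis .
  qed
  have "(\<integral>\<^sup>+C. emeasure \<nu> C * emeasure \<nu> C * k C \<partial>count_space \<C>)
    = (\<integral>\<^sup>+C. (\<integral>\<^sup>+x. (k C * emeasure \<nu> C) * indicator C x \<partial>\<nu>) \<partial>count_space \<C>)"
  proof (intro nn_integral_cong)
    fix C assume "C \<in> space (count_space \<C>)"
    then have "(\<integral>\<^sup>+x. (k C * emeasure \<nu> C) * indicator C x \<partial>\<nu>) = (k C * emeasure \<nu> C) * emeasure \<nu> C"
      using meas by (intro nn_integral_cmult_indicator) auto
    then show "emeasure \<nu> C * emeasure \<nu> C * k C = (\<integral>\<^sup>+x. (k C * emeasure \<nu> C) * indicator C x \<partial>\<nu>)"
      by (simp add: mult_ac)
  qed
  also have "\<dots> = (\<integral>\<^sup>+x. (\<integral>\<^sup>+C. (k C * emeasure \<nu> C) * indicator C x \<partial>count_space \<C>) \<partial>\<nu>)"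
    using meas countable_dyadic_family[OF \<C>(1)]
    by (intro nn_integral_count_space_nn_integral[symmetric]) auto
  also have "\<dots> \<le> (\<integral>\<^sup>+x. (\<integral>\<^sup>+y. h x y \<partial>\<nu>) \<partial>\<nu>)"
    by (intro nn_integral_mono inner)
  finally show ?thesis by (simp add: dyadic_energy_def h_def k_def)
qed

lemma frontier_dyadic_cube_null:
  assumes "sets \<mu> = sets borel" "emeasure \<mu> (dyadic_boundary P) = 0" "D \<in> dyadic_cubes P"
  shows "emeasure \<mu> (frontier D) = 0"
proof -
  have eq: "dyadic_boundary P = (\<Union>D\<in>dyadic_cubes P. frontier D)"
    by (auto simp: dyadic_boundary_def dyadic_cubes_def)
  have "dyadic_boundary P \<in> sets \<mu>"
    unfolding eq assms(1)
    using countable_dyadic_family[of "dyadic_cubes P" P] by (intro sets.countable_UN') auto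
  moreover have "frontier D \<subseteq> dyadic_boundary P" using assms(3) eq by blast
  ultimately show ?thesis using assms(2) emeasure_mono[of "frontier D" "dyadic_boundary P" \<mu>] by simp
qed

lemma emeasure_le_sum_cover:
  assumes s\<nu>: "sets \<nu> = sets borel"
    and \<C>: "\<C> \<subseteq> dyadic_cubes P" "\<And>A B. A \<in> \<C> \<Longrightarrow> B \<in> \<C> \<Longrightarrow> A \<inter> B \<noteq> {} \<Longrightarrow> A = B"
    and cov: "measure_support \<nu> \<inter> D \<subseteq> \<Union>\<C>"
  shows "emeasure \<nu> D \<le> (\<integral>\<^sup>+C. emeasure \<nu> C \<partial>count_space \<C>)"
proof -
  have cnt: "countable \<C>" using \<C>(1) by (rule countable_dyadic_family)
  have meas: "C \<in> sets \<nu>" if "C \<in> \<C>" for C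
    using that \<C>(1) borel_dyadic_cube s\<nu> by blast
  then have UC: "(\<Union>C\<in>\<C>. C) \<in> sets \<nu>" using cnt by (intro sets.countable_UN') auto
  have null: "- measure_support \<nu> \<in> null_sets \<nu>" using s\<nu> by (rule complement_measure_support_null)
  have "emeasure \<nu> D \<le> emeasure \<nu> ((\<Union>C\<in>\<C>. C) \<union> - measure_support \<nu>)"
    using cov UC null by (intro emeasure_mono) auto
  also have "\<dots> = emeasure \<nu> (\<Union>C\<in>\<C>. C)" using UC null by (rule emeasure_Un_null_set)
  also have "\<dots> = (\<integral>\<^sup>+C. emeasure \<nu> C \<partial>count_space \<C>)"
    using cnt meas \<C>(2) by (intro emeasure_UN_countable) (auto simp: disjoint_family_on_def)
  finally show ?thesis .
qed

text \<open>
  Each such cube adds at least \<open>t powr \<eta>\<close> to the cost.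
\<close>

lemma finite_large_members:
  assumes "cover_cost \<mu> \<eta> \<C> < \<infinity>" "0 < t" "0 < \<eta>"
  shows "finite {C \<in> \<C>. ennreal t \<le> emeasure \<mu> C}"
proof (rule ccontr)
  define F where "F = {C \<in> \<C>. ennreal t \<le> emeasure \<mu> C}"
  assume "infinite {C \<in> \<C>. ennreal t \<le> emeasure \<mu> C}"
  then have inf: "infinite F" by (simp add: F_def)
  have "\<infinity> = (\<integral>\<^sup>+C. ennreal (t powr \<eta>) \<partial>count_space F)"
    using inf assms(2) by (simp add: ennreal_mult_top)
  also have "\<dots> \<le> cover_cost \<mu> \<eta> F"
    unfolding cover_cost_def
  proof (intro nn_integral_mono)
    fix C assume "C \<in> space (count_space F)"
    then have "ennreal_powr (ennreal t) \<eta> \<le> ennreal_powr (emeasure \<mu> C) \<eta>"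
      using assms(3) by (intro ennreal_powr_mono) (auto simp: F_def)
    then show "ennreal (t powr \<eta>) \<le> ennreal_powr (emeasure \<mu> C) \<eta>"
      using assms(2) by (simp add: ennreal_powr_ennreal)
  qed
  also have "\<dots> \<le> cover_cost \<mu> \<eta> \<C>" by (intro cover_cost_mono) (auto simp: F_def)
  finally show False using assms(1) by simp
qed

text \<open>
  The energy bound prevents the mass of \<open>\<nu> n\<close> from sitting in cubes of tiny \<open>\<mu>\<close>-measure, and on
  the finitely many other cubes of the cover \<open>\<nu> n\<close> is close to \<open>\<mu>\<close>. It is essential here that the
  cover is fixed while \<open>n\<close> tends to infinity, which is why \<open>U\<close> has to contain the supports of all
  late \<open>\<nu> n\<close>.
\<close>

lemma dyadically_full_of_bounded_energy:
  assumes s\<mu>: "sets \<mu> = sets borel" and bd: "emeasure \<mu> (dyadic_boundary P) = 0"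
    and s\<nu>: "\<And>n. sets (\<nu> n) = sets borel" and conv: "weakly_converges \<nu> \<mu>"
    and \<eta>: "0 < \<eta>" "\<eta> < \<eta>'" "\<eta> \<le> 1"
    and en: "\<And>n. dyadic_energy P \<mu> \<eta>' (\<nu> n) \<le> ennreal c"
    and supp: "\<And>n. k \<le> n \<Longrightarrow> measure_support (\<nu> n) \<subseteq> U"
  shows "dyadically_full P \<mu> \<eta> U"
  unfolding dyadically_full_def
proof (intro ballI allI impI)
  fix D \<C> assume D: "D \<in> dyadic_cubes P" and \<C>: "\<C> \<subseteq> dyadic_cubes P" and cov: "U \<inter> D \<subseteq> \<Union>\<C>"
  have cube: "emeasure \<mu> C < \<infinity>" "emeasure (\<nu> n) C < \<infinity>"
      "(\<lambda>n. measure (\<nu> n) C) \<longlonglongrightarrow> measure \<mu> C"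
    if "C \<in> dyadic_cubes P" for C n
    using weak_convergence_bounded_continuity_set[OF conv s\<mu> s\<nu> borel_dyadic_cube[OF that]
        bounded_dyadic_cube[OF that] frontier_dyadic_cube_null[OF s\<mu> bd that]] by blast+
  have em: "emeasure \<mu> C = ennreal (measure \<mu> C)" "emeasure (\<nu> n) C = ennreal (measure (\<nu> n) C)"
    if "C \<in> dyadic_cubes P" for C n
    using cube(1,2)[OF that] by (auto simp: emeasure_eq_ennreal_measure less_top)
  show "ennreal_powr (emeasure \<mu> D) \<eta> \<le> cover_cost \<mu> \<eta> \<C>"
  proof (cases "(\<exists>C\<in>\<C>. D \<subseteq> C) \<or> cover_cost \<mu> \<eta> \<C> = \<infinity> \<or> measure \<mu> D = 0")
    case True
    then consider C where "C \<in> \<C>" "D \<subseteq> C" | "cover_cost \<mu> \<eta> \<C> = \<infinity>" | "measure \<mu> D = 0" by blast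
    then show ?thesis
    proof cases
      case 1
      then have "ennreal_powr (emeasure \<mu> D) \<eta> \<le> ennreal_powr (emeasure \<mu> C) \<eta>"
        using \<C> s\<mu> \<eta> borel_dyadic_cube[of C P] by (intro ennreal_powr_mono emeasure_mono) auto
      also have "\<dots> \<le> cover_cost \<mu> \<eta> \<C>" using 1 by (intro cover_cost_ge_member)
      finally show ?thesis .
    next
      case 3
      then show ?thesis using D \<eta> by (simp add: em ennreal_powr_def)
    qed simp
  next
    case False
    define b where "b = measure \<mu> D"
    have b: "0 < b" using False by (simp add: b_def zero_less_measure_iff)
    \<comment> \<open>As no member contains \<open>D\<close>, those that meet \<open>D\<close> lie in \<open>D\<close>; the maximal ones are disjoint.\<close>
    define \<D> where "\<D> = {C \<in> \<C>. C \<inter> D \<noteq> {}}"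
    define \<M> where "\<M> = maximal_members \<D>"
    have \<D>D: "C \<subseteq> D" if "C \<in> \<D>" for C
      using that dyadic_cubes_nested[of C P D] D \<C> False by (auto simp: \<D>_def)
    have \<D>c: "\<D> \<subseteq> dyadic_cubes P" using \<C> by (auto simp: \<D>_def)
    have \<M>\<D>: "\<M> \<subseteq> \<D>" by (auto simp: \<M>_def maximal_members_def)
    have \<M>c: "\<M> \<subseteq> dyadic_cubes P" using \<M>\<D> \<D>c by blast
    have disj: "A = B" if "A \<in> \<M>" "B \<in> \<M>" "A \<inter> B \<noteq> {}" for A B
      using maximal_members_disjoint[OF \<D>c] that by (simp add: \<M>_def)
    have cov\<M>: "U \<inter> D \<subseteq> \<Union>\<M>"
    proof
      fix x assume x: "x \<in> U \<inter> D"
      then obtain C where "C \<in> \<D>" "x \<in> C" using cov by (auto simp: \<D>_def)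
      moreover obtain M where "M \<in> \<M>" "C \<subseteq> M"
        using maximal_dyadic_cube_above[OF \<D>c D \<D>D \<open>C \<in> \<D>\<close>] unfolding \<M>_def by metis
      ultimately show "x \<in> \<Union>\<M>" by blast
    qed
    have le\<C>: "cover_cost \<mu> \<eta> \<M> \<le> cover_cost \<mu> \<eta> \<C>"
      using \<M>\<D> by (intro cover_cost_mono) (auto simp: \<D>_def)
    have fin\<M>: "cover_cost \<mu> \<eta> \<M> < \<infinity>"
      using le\<C> False by (metis infinity_ennreal_def le_less_trans less_top)
    define S where "S = enn2real (cover_cost \<mu> \<eta> \<M>)"
    have S: "cover_cost \<mu> \<eta> \<M> = ennreal S" "0 \<le> S"
      using fin\<M> by (auto simp: S_def less_top)
    define c' where "c' = max c 0"
    have c': "0 \<le> c'" and en': "dyadic_energy P \<mu> \<eta>' (\<nu> n) \<le> ennreal c'" for n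
      using en[of n] order_trans[of _ "ennreal c" "ennreal c'"] by (auto simp: c'_def ennreal_leI)
    have key: "b \<le> b powr (1 - \<eta>) * S + \<delta> * (S + 1)" if \<delta>: "0 < \<delta>" for \<delta>
    proof -
      \<comment> \<open>The threshold is chosen so that all cubes below it contribute at most \<open>\<delta> * S + \<delta>\<close>.\<close>
      define t where "t = (\<delta> * \<delta> / (c' + 1)) powr (1 / (\<eta>' - \<eta>))"
      define K where "K = t powr (\<eta>' - \<eta>) / \<delta>"
      have t: "0 < t" using \<delta> c' by (simp add: t_def)
      have "K = \<delta> / (c' + 1)" using \<delta> c' \<eta> by (simp add: K_def t_def powr_powr)
      then have "K * (c' + 1) = \<delta>" using c' by simp
      moreover have "0 \<le> K" using \<delta> by (simp add: K_def)
      ultimately have K: "0 \<le> K" "K * c' \<le> \<delta>" by (simp_all add: distrib_left)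
      define F where "F = {C \<in> \<M>. ennreal t \<le> emeasure \<mu> C}"
      have F: "finite F" "F \<subseteq> \<M>"
        unfolding F_def using finite_large_members[OF fin\<M> t \<eta>(1)] by auto
      have tF: "t \<le> measure \<mu> C" if "C \<in> F" for C
      proof -
        have "C \<in> dyadic_cubes P" "ennreal t \<le> emeasure \<mu> C" using that \<M>c by (auto simp: F_def)
        then show ?thesis using em(1)[of C] by simp
      qed
      have step: "measure (\<nu> n) D \<le> (\<Sum>C\<in>F. measure (\<nu> n) C) + \<delta> * (S + 1)" if n: "k \<le> n" for n
      proof -
        define e where "e C = emeasure (\<nu> n) C * emeasure (\<nu> n) C * ennreal_powr (emeasure \<mu> C) (- \<eta>')" for C
        have "emeasure (\<nu> n) D \<le> (\<integral>\<^sup>+C. emeasure (\<nu> n) C \<partial>count_space \<M>)"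
          using supp[OF n] cov\<M> by (intro emeasure_le_sum_cover[OF s\<nu> \<M>c disj]) auto
        also have "\<dots> \<le> (\<integral>\<^sup>+C. emeasure (\<nu> n) C * indicator F C +
            (ennreal \<delta> * ennreal_powr (emeasure \<mu> C) \<eta> + ennreal K * e C) \<partial>count_space \<M>)"
        proof (intro nn_integral_mono)
          fix C assume "C \<in> space (count_space \<M>)"
          then have C: "C \<in> \<M>" "C \<in> dyadic_cubes P" using \<M>c by auto
          show "emeasure (\<nu> n) C \<le> emeasure (\<nu> n) C * indicator F C +
            (ennreal \<delta> * ennreal_powr (emeasure \<mu> C) \<eta> + ennreal K * e C)"
          proof (cases "C \<in> F")
            case True
            then show ?thesis by simp
          next
            case False
            then have "measure \<mu> C < t" using C em(1)[of C] by (auto simp: F_def not_le ennreal_less_iff)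
            then show ?thesis
              using False small_cube_estimate[of "measure (\<nu> n) C" "measure \<mu> C" t \<delta> \<eta> \<eta>'] \<delta> \<eta>
              by (simp add: e_def K_def em[OF C(2)])
          qed
        qed
        also have "\<dots> = (\<integral>\<^sup>+C. emeasure (\<nu> n) C * indicator F C \<partial>count_space \<M>) +
            (ennreal \<delta> * cover_cost \<mu> \<eta> \<M> + ennreal K * (\<integral>\<^sup>+C. e C \<partial>count_space \<M>))"
          by (simp add: nn_integral_add nn_integral_cmult cover_cost_def)
        also have "(\<integral>\<^sup>+C. emeasure (\<nu> n) C * indicator F C \<partial>count_space \<M>) = (\<Sum>C\<in>F. emeasure (\<nu> n) C)"
          by (subst nn_integral_count_space'[OF F(1)]) (use F in auto)
        also have "\<dots> = ennreal (\<Sum>C\<in>F. measure (\<nu> n) C)"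
        proof -
          have "(\<Sum>C\<in>F. emeasure (\<nu> n) C) = (\<Sum>C\<in>F. ennreal (measure (\<nu> n) C))"
            using F(2) \<M>c by (intro sum.cong refl em(2)) blast
          then show ?thesis by simp
        qed
        also have "(\<integral>\<^sup>+C. e C \<partial>count_space \<M>) \<le> ennreal c'"
          unfolding e_def using \<eta> en'[of n]
          by (intro order_trans[OF energy_ge_disjoint_cubes[OF s\<nu> s\<mu> _ \<M>c disj]]) auto
        finally have "ennreal (measure (\<nu> n) D) \<le> ennreal (\<Sum>C\<in>F. measure (\<nu> n) C) +
            (ennreal \<delta> * ennreal S + ennreal K * ennreal c')"
          unfolding S(1) em(2)[OF D] by (simp add: add_left_mono mult_left_mono)
        also have "\<dots> = ennreal ((\<Sum>C\<in>F. measure (\<nu> n) C) + (\<delta> * S + K * c'))"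
          using \<delta> S K c' by (simp add: sum_nonneg flip: ennreal_mult ennreal_plus)
        finally have "measure (\<nu> n) D \<le> (\<Sum>C\<in>F. measure (\<nu> n) C) + (\<delta> * S + K * c')"
          using \<delta> S K c' by (subst (asm) ennreal_le_iff) (auto intro!: add_nonneg_nonneg sum_nonneg)
        then show ?thesis using K by (simp add: algebra_simps)
      qed
      have "(\<lambda>n. (\<Sum>C\<in>F. measure (\<nu> n) C) + \<delta> * (S + 1)) \<longlonglongrightarrow> (\<Sum>C\<in>F. measure \<mu> C) + \<delta> * (S + 1)"
        using F \<M>c by (intro tendsto_intros cube(3)) auto
      moreover have "(\<lambda>n. measure (\<nu> n) D) \<longlonglongrightarrow> b" unfolding b_def using D by (intro cube(3))
      ultimately have "b \<le> (\<Sum>C\<in>F. measure \<mu> C) + \<delta> * (S + 1)"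
        by (rule tendsto_le[OF sequentially_bot]) (use step in \<open>auto simp: eventually_sequentially\<close>)
      also have "(\<Sum>C\<in>F. measure \<mu> C) \<le> (\<Sum>C\<in>F. b powr (1 - \<eta>) * measure \<mu> C powr \<eta>)"
      proof (intro sum_mono)
        fix C assume C: "C \<in> F"
        have pos: "0 < measure \<mu> C" using tF[OF C] t by simp
        have "emeasure \<mu> C \<le> emeasure \<mu> D"
          using C F \<M>\<D> \<D>D D s\<mu> borel_dyadic_cube[of D P] by (intro emeasure_mono) auto
        then have "measure \<mu> C \<le> b" using C F \<M>c D b by (auto simp: em b_def)
        have "measure \<mu> C = measure \<mu> C powr (1 - \<eta>) * measure \<mu> C powr \<eta>"
          using pos by (simp flip: powr_add)
        also have "\<dots> \<le> b powr (1 - \<eta>) * measure \<mu> C powr \<eta>"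
          using \<open>measure \<mu> C \<le> b\<close> \<eta> by (intro mult_right_mono powr_mono2) auto
        finally show "measure \<mu> C \<le> b powr (1 - \<eta>) * measure \<mu> C powr \<eta>" .
      qed
      also have "\<dots> = b powr (1 - \<eta>) * (\<Sum>C\<in>F. measure \<mu> C powr \<eta>)" by (simp add: sum_distrib_left)
      also have "(\<Sum>C\<in>F. measure \<mu> C powr \<eta>) \<le> S"
      proof -
        have "ennreal (\<Sum>C\<in>F. measure \<mu> C powr \<eta>) = (\<Sum>C\<in>F. ennreal_powr (emeasure \<mu> C) \<eta>)"
        proof -
          have "ennreal (measure \<mu> C powr \<eta>) = ennreal_powr (emeasure \<mu> C) \<eta>" if C: "C \<in> F" for C
          proof -
            have "C \<in> dyadic_cubes P" "0 < measure \<mu> C" using C F \<M>c tF[OF C] t by auto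
            then show ?thesis by (simp add: em ennreal_powr_ennreal)
          qed
          then have "(\<Sum>C\<in>F. ennreal (measure \<mu> C powr \<eta>)) = (\<Sum>C\<in>F. ennreal_powr (emeasure \<mu> C) \<eta>)"
            by (rule sum.cong[OF refl])
          then show ?thesis by simp
        qed
        also have "\<dots> \<le> ennreal S"
          using cover_cost_mono[OF F(2), of \<mu> \<eta>] F(1) by (simp add: cover_cost_finite S(1))
        finally show ?thesis using S(2) by simp
      qed
      finally show ?thesis by (simp add: mult_left_mono)
    qed
    have "b \<le> b powr (1 - \<eta>) * S"
    proof (rule field_le_epsilon)
      fix e :: real assume "0 < e"
      then show "b \<le> b powr (1 - \<eta>) * S + e" using key[of "e / (S + 1)"] S(2) by simp
    qed
    moreover have "b = b powr (1 - \<eta>) * b powr \<eta>" using b by (simp flip: powr_add)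
    ultimately have "b powr (1 - \<eta>) * b powr \<eta> \<le> b powr (1 - \<eta>) * S" by simp
    then have "b powr \<eta> \<le> S" using b by (simp only: mult_le_cancel_left_pos powr_gt_zero)
    then have "ennreal_powr (emeasure \<mu> D) \<eta> \<le> cover_cost \<mu> \<eta> \<M>"
      using b D S by (simp add: em ennreal_powr_ennreal b_def ennreal_leI)
    then show ?thesis using le\<C> by (rule order_trans)
  qed
qed

section \<open>Countable intersections of full open sets\<close>

text \<open>
  The cubes in which the cover is too cheap. A member that contains \<open>Q\<close> covers it without entering the
  sum over the members inside \<open>Q\<close>, so such members have to be excluded.
\<close>

definition undercovered :: "(real ^ 'd) measure \<Rightarrow> real \<Rightarrow> (real ^ 'd) set set \<Rightarrow> (real ^ 'd) set \<Rightarrow> bool" where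
  "undercovered \<mu> \<eta> \<C> Q \<longleftrightarrow>
     (\<forall>C\<in>\<C>. \<not> Q \<subseteq> C) \<and> cover_cost \<mu> \<eta> {C \<in> \<C>. C \<subseteq> Q} < ennreal_powr (emeasure \<mu> Q) \<eta>"

text \<open>
  If there were no such \<open>Q'\<close>, then \<open>\<C>\<close> could be turned into a cover of \<open>U \<inter> Q\<close> that is
  still too cheap, contrary to the fullness of \<open>U\<close>. Decompose \<open>U \<inter> Q\<close> into the maximal cubes \<open>W\<close> with closure inside it, as in a
  Whitney decomposition, and in each \<open>W\<close> that lies in no member of \<open>\<C>\<close> replace all the members inside
  \<open>W\<close> by \<open>W\<close> itself. If no such \<open>W\<close> is undercovered, this does not increase the cost.
\<close>

lemma undercovered_refine:
  assumes U: "open U" "dyadically_full P \<mu> \<eta> U" and \<C>: "\<C> \<subseteq> dyadic_cubes P"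
    and Q: "Q \<in> dyadic_cubes P" "undercovered \<mu> \<eta> \<C> Q"
  obtains Q' where "Q' \<in> dyadic_cubes P" "undercovered \<mu> \<eta> \<C> Q'" "Q' \<noteq> Q" "closure Q' \<subseteq> Q \<inter> U"
proof -
  define \<W> where "\<W> = {W \<in> dyadic_cubes P. W \<noteq> Q \<and> closure W \<subseteq> Q \<inter> U}"
  define \<M> where "\<M> = maximal_members \<W>"
  define sub where "sub W = {C \<in> \<C>. C \<subseteq> W}" for W
  define \<W>' where "\<W>' = {W \<in> \<M>. \<forall>C\<in>\<C>. \<not> W \<subseteq> C}"
  define \<C>' where "\<C>' = {C \<in> sub Q. \<forall>W\<in>\<W>'. \<not> C \<subseteq> W}"
  have \<W>c: "\<W> \<subseteq> dyadic_cubes P" by (auto simp: \<W>_def)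
  have \<W>Q: "W \<subseteq> Q" if "W \<in> \<W>" for W using that closure_subset[of W] by (auto simp: \<W>_def)
  have \<M>\<W>: "\<M> \<subseteq> \<W>" by (auto simp: \<M>_def maximal_members_def)
  have disj: "A = B" if "A \<in> \<M>" "B \<in> \<M>" "A \<inter> B \<noteq> {}" for A B
    using maximal_members_disjoint[OF \<W>c] that by (simp add: \<M>_def)
  have "\<exists>W\<in>\<W>'. undercovered \<mu> \<eta> \<C> W"
  proof (rule ccontr)
    assume "\<not> (\<exists>W\<in>\<W>'. undercovered \<mu> \<eta> \<C> W)"
    then have good: "ennreal_powr (emeasure \<mu> W) \<eta> \<le> cover_cost \<mu> \<eta> (sub W)" if "W \<in> \<W>'" for W
      using that by (auto simp: undercovered_def sub_def \<W>'_def not_less)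
    have cov: "U \<inter> Q \<subseteq> \<Union>(\<C>' \<union> \<W>')"
    proof
      fix x assume x: "x \<in> U \<inter> Q"
      obtain W0 where W0: "W0 \<in> \<W>" "x \<in> W0"
        using dyadic_cube_refine[OF Q(1) U(1)] x unfolding \<W>_def by (metis (mono_tags, lifting) IntD1 IntD2 mem_Collect_eq)
      obtain W where W: "W \<in> \<M>" "W0 \<subseteq> W"
        using maximal_dyadic_cube_above[OF \<W>c Q(1) \<W>Q W0(1)] unfolding \<M>_def by metis
      show "x \<in> \<Union>(\<C>' \<union> \<W>')"
      proof (cases "W \<in> \<W>'")
        case True
        then show ?thesis using W W0 by blast
      next
        case False
        then obtain C where C: "C \<in> \<C>" "W \<subseteq> C" using W by (auto simp: \<W>'_def)
        have "x \<in> C" using C W W0 by blast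
        have "C \<subseteq> Q"
          using dyadic_cubes_nested[of C P Q] C \<C> Q \<open>x \<in> C\<close> x by (auto simp: undercovered_def)
        moreover have "\<not> C \<subseteq> W'" if W': "W' \<in> \<W>'" for W'
        proof
          assume "C \<subseteq> W'"
          then have "W \<subseteq> W'" using C by blast
          moreover have "W \<noteq> {}" using W(1) \<M>\<W> \<W>c dyadic_cube_nonempty by blast
          ultimately have "W \<inter> W' \<noteq> {}" by blast
          moreover have "W' \<in> \<M>" using W' by (simp add: \<W>'_def)
          ultimately have "W = W'" using disj W(1) by blast
          then show False using False W' by simp
        qed
        ultimately have "C \<in> \<C>'" using C by (auto simp: \<C>'_def sub_def)
        then show ?thesis using \<open>x \<in> C\<close> by blast
      qed
    qed
    let ?N = "density (count_space UNIV) (\<lambda>C. ennreal_powr (emeasure \<mu> C) \<eta>)"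
    have "\<C>' \<union> \<W>' \<subseteq> dyadic_cubes P"
      using \<C> \<M>\<W> \<W>c by (auto simp: \<C>'_def sub_def \<W>'_def)
    then have "ennreal_powr (emeasure \<mu> Q) \<eta> \<le> cover_cost \<mu> \<eta> (\<C>' \<union> \<W>')"
      using U(2) Q(1) cov unfolding dyadically_full_def by blast
    also have "\<dots> \<le> cover_cost \<mu> \<eta> \<C>' + cover_cost \<mu> \<eta> \<W>'"
      unfolding cover_cost_eq_emeasure by (rule emeasure_subadditive) auto
    also have "cover_cost \<mu> \<eta> \<W>' \<le> (\<integral>\<^sup>+W. emeasure ?N (sub W) \<partial>count_space \<W>')"
      unfolding cover_cost_def[of _ _ \<W>'] cover_cost_eq_emeasure[symmetric]
      using good by (intro nn_integral_mono) auto
    also have "\<dots> = emeasure ?N (\<Union>W\<in>\<W>'. sub W)"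
    proof (rule emeasure_UN_countable[symmetric])
      show "countable \<W>'"
        using countable_dyadic_family[of \<W>' P] \<M>\<W> \<W>c by (auto simp: \<W>'_def)
      show "disjoint_family_on sub \<W>'"
        unfolding disjoint_family_on_def
      proof (intro ballI impI)
        fix A B assume AB: "A \<in> \<W>'" "B \<in> \<W>'" "A \<noteq> B"
        show "sub A \<inter> sub B = {}"
        proof (rule ccontr)
          assume "sub A \<inter> sub B \<noteq> {}"
          then obtain C where "C \<in> \<C>" "C \<subseteq> A" "C \<subseteq> B" by (auto simp: sub_def)
          then have "A \<inter> B \<noteq> {}" using dyadic_cube_nonempty \<C> by blast
          then show False using disj AB by (auto simp: \<W>'_def)
        qed
      qed
    qed simp
    finally have "ennreal_powr (emeasure \<mu> Q) \<eta> \<le> emeasure ?N \<C>' + emeasure ?N (\<Union>W\<in>\<W>'. sub W)"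
      by (simp add: cover_cost_eq_emeasure add_left_mono)
    also have "\<dots> = emeasure ?N (\<C>' \<union> (\<Union>W\<in>\<W>'. sub W))"
      by (rule plus_emeasure) (auto simp: \<C>'_def sub_def)
    also have "\<dots> \<le> cover_cost \<mu> \<eta> (sub Q)"
      unfolding cover_cost_eq_emeasure
    proof (rule emeasure_mono)
      show "\<C>' \<union> (\<Union>W\<in>\<W>'. sub W) \<subseteq> sub Q"
        using \<M>\<W> \<W>Q unfolding \<C>'_def sub_def \<W>'_def by blast
    qed simp
    finally show False using Q(2) by (simp add: undercovered_def sub_def not_less[symmetric])
  qed
  then show ?thesis
    using that \<M>\<W> unfolding \<W>'_def \<W>_def by blast
qed

text \<open>
  Iterating the refinement gives nested undercovered cubes \<open>Q n\<close> that shrink into every \<open>G n\<close>, and by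
  compactness a common point \<open>x\<close>. A member of the cover containing \<open>x\<close> contains no \<open>Q n\<close>, hence lies
  in all of them, but there are only finitely many cubes between it and \<open>D\<close>.
\<close>

lemma dyadically_full_INT:
  fixes G :: "nat \<Rightarrow> (real ^ 'd) set"
  assumes s\<mu>: "sets \<mu> = sets borel" and \<eta>: "0 < \<eta>"
    and G: "\<And>j. open (G j)" "\<And>j. dyadically_full P \<mu> \<eta> (G j)"
  shows "dyadically_full P \<mu> \<eta> (\<Inter>j. G j)"
  unfolding dyadically_full_def
proof (intro ballI allI impI, rule ccontr)
  fix D \<C> assume D: "D \<in> dyadic_cubes P" and \<C>: "\<C> \<subseteq> dyadic_cubes P"
    and cov: "(\<Inter>j. G j) \<inter> D \<subseteq> \<Union>\<C>"
    and less: "\<not> ennreal_powr (emeasure \<mu> D) \<eta> \<le> cover_cost \<mu> \<eta> \<C>"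
  have "\<not> D \<subseteq> C" if "C \<in> \<C>" for C
  proof
    assume "D \<subseteq> C"
    then have "ennreal_powr (emeasure \<mu> D) \<eta> \<le> ennreal_powr (emeasure \<mu> C) \<eta>"
      using that \<C> s\<mu> \<eta> borel_dyadic_cube[of C P] by (intro ennreal_powr_mono emeasure_mono) auto
    then show False using less cover_cost_ge_member[OF that, of \<mu> \<eta>] by auto
  qed
  moreover have "cover_cost \<mu> \<eta> {C \<in> \<C>. C \<subseteq> D} < ennreal_powr (emeasure \<mu> D) \<eta>"
    using less cover_cost_mono[of "{C \<in> \<C>. C \<subseteq> D}" \<C> \<mu> \<eta>] by (auto simp: not_le)
  ultimately have uD: "undercovered \<mu> \<eta> \<C> D" by (auto simp: undercovered_def)
  have "\<exists>Q. \<forall>n. (Q n \<in> dyadic_cubes P \<and> undercovered \<mu> \<eta> \<C> (Q n) \<and> Q n \<subseteq> D) \<and>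
      (Q (Suc n) \<noteq> Q n \<and> closure (Q (Suc n)) \<subseteq> Q n \<inter> G n)"
  proof (rule dependent_nat_choice)
    show "\<exists>x. x \<in> dyadic_cubes P \<and> undercovered \<mu> \<eta> \<C> x \<and> x \<subseteq> D" using D uD by blast
    fix Q n assume Q: "Q \<in> dyadic_cubes P \<and> undercovered \<mu> \<eta> \<C> Q \<and> Q \<subseteq> D"
    then obtain Q' where "Q' \<in> dyadic_cubes P" "undercovered \<mu> \<eta> \<C> Q'" "Q' \<noteq> Q" "closure Q' \<subseteq> Q \<inter> G n"
      using undercovered_refine[OF G \<C>, of Q n] by metis
    moreover then have "Q' \<subseteq> D" using Q closure_subset[of Q'] by blast
    ultimately show "\<exists>y. (y \<in> dyadic_cubes P \<and> undercovered \<mu> \<eta> \<C> y \<and> y \<subseteq> D) \<and>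
       (y \<noteq> Q \<and> closure y \<subseteq> Q \<inter> G n)" by blast
  qed
  then obtain Q where Q: "\<And>n. Q n \<in> dyadic_cubes P" "\<And>n. undercovered \<mu> \<eta> \<C> (Q n)" "\<And>n. Q n \<subseteq> D"
    and ne: "\<And>n. Q (Suc n) \<noteq> Q n" and cl: "\<And>n. closure (Q (Suc n)) \<subseteq> Q n \<inter> G n" by blast
  have sub: "Q (Suc n) \<subset> Q n" for n using cl[of n] closure_subset[of "Q (Suc n)"] ne[of n] by blast
  have mono: "Q n \<subseteq> Q m" if "m \<le> n" for m n
    using lift_Suc_antimono_le[of Q, OF _ that] sub by blast
  have strict: "Q n \<noteq> Q m" if "m < n" for m n
    using mono[of "Suc m" n] sub[of m] that by auto
  have "(\<Inter>n. closure (Q n)) \<noteq> {}"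
  proof (rule compact_nest)
    show "compact (closure (Q n))" for n using bounded_dyadic_cube[OF Q(1)] by (simp add: compact_closure)
    show "closure (Q n) \<noteq> {}" for n using dyadic_cube_nonempty[OF Q(1)] by simp
    show "closure (Q n) \<subseteq> closure (Q m)" if "m \<le> n" for m n using mono[OF that] by (rule closure_mono)
  qed
  then obtain x where "\<And>n. x \<in> closure (Q n)" by blast
  then have xQ: "x \<in> Q n" and xG: "x \<in> G n" for n using cl[of n] by blast+
  then obtain C where C: "C \<in> \<C>" "x \<in> C" using cov Q(3)[of 0] by blast
  have "C \<subseteq> Q n" for n
    using dyadic_cubes_nested[of C P "Q n"] C \<C> Q(1,2)[of n] xQ[of n] by (auto simp: undercovered_def)
  then have "range Q \<subseteq> {B \<in> dyadic_cubes P. C \<subseteq> B \<and> B \<subseteq> D}" using Q by blast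
  then have "finite (range Q)" using finite_dyadic_cubes_supset[of C P D] C \<C> D finite_subset by blast
  moreover have "inj Q" using strict by (metis injI linorder_neqE_nat)
  ultimately show False using finite_imageD[of Q UNIV] by simp
qed

section \<open>Limsup sets\<close>

lemma dyadic_content_eq_of_dyadically_full:
  assumes "dyadically_full P \<mu> \<eta> U" "D \<in> dyadic_cubes P"
  shows "dyadic_content P \<mu> \<eta> (U \<inter> D) = dyadic_content P \<mu> \<eta> D"
proof (rule antisym)
  show "dyadic_content P \<mu> \<eta> (U \<inter> D) \<le> dyadic_content P \<mu> \<eta> D"
    unfolding dyadic_content_def by (intro INF_superset_mono) auto
  have "dyadic_content P \<mu> \<eta> D \<le> (\<Sum>\<^sub>\<infinity>C\<in>{D}. ennreal_powr (emeasure \<mu> C) \<eta>)"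
    unfolding dyadic_content_def using assms(2) by (intro INF_lower) auto
  also have "\<dots> = ennreal_powr (emeasure \<mu> D) \<eta>" by simp
  also have "\<dots> \<le> dyadic_content P \<mu> \<eta> (U \<inter> D)"
    unfolding dyadic_content_def
  proof (intro INF_greatest)
    fix \<C> assume \<C>: "\<C> \<in> {\<C>. \<C> \<subseteq> dyadic_cubes P \<and> countable \<C> \<and> U \<inter> D \<subseteq> \<Union>\<C>}"
    then have "ennreal_powr (emeasure \<mu> D) \<eta> \<le> cover_cost \<mu> \<eta> \<C>"
      using assms unfolding dyadically_full_def by blast
    also have "\<dots> \<le> (\<Sum>\<^sub>\<infinity>C\<in>\<C>. ennreal_powr (emeasure \<mu> C) \<eta>)"
      unfolding cover_cost_def using \<C> by (intro nn_integral_count_space_le_infsum) auto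
    finally show "ennreal_powr (emeasure \<mu> D) \<eta> \<le> (\<Sum>\<^sub>\<infinity>C\<in>\<C>. ennreal_powr (emeasure \<mu> C) \<eta>)" .
  qed
  finally show "dyadic_content P \<mu> \<eta> D \<le> dyadic_content P \<mu> \<eta> (U \<inter> D)" .
qed

theorem lemma2p7:
  fixes P :: "real ^ 'd"
    and \<mu> :: "(real ^ 'd) measure"
    and \<theta> :: real
    and E :: "nat \<Rightarrow> (real ^ 'd) set"
    and \<mu>s :: "nat \<Rightarrow> (real ^ 'd) measure"
  assumes "sets \<mu> = sets borel"
    and "nonatomic \<mu>"
    and "locally_finite_measure \<mu>"
    and "emeasure \<mu> (dyadic_boundary P) = 0"
    and "0 < \<theta>" and "\<theta> \<le> 1"
    and "\<And>n. open (E n)"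
    and "\<And>n. sets (\<mu>s n) = sets borel"
    and "\<And>n. nonatomic (\<mu>s n)"
    and "\<And>n. measure_support (\<mu>s n) \<subseteq> E n"
    and "weakly_converges \<mu>s \<mu>"
    and "\<And>\<eta>. 0 < \<eta> \<Longrightarrow> \<eta> < \<theta> \<Longrightarrow> \<exists>c::real. \<forall>n. dyadic_energy P \<mu> \<eta> (\<mu>s n) \<le> ennreal c"
  shows "(\<Inter>k\<in>{1..}. \<Union>n\<in>{k..}. E n) \<in> large_intersection_class P \<mu> \<theta>"
proof -
  define G where "G j = (\<Union>n\<in>{Suc j..}. E n)" for j
  \<comment> \<open>Reindexed from \<open>0\<close>, the form of a \<open>G\<^sub>\<delta>\<close> set.\<close>
  have eq: "(\<Inter>k\<in>{1..}. \<Union>n\<in>{k..}. E n) = (\<Inter>j. G j)"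
  proof -
    have "{1..} = range Suc" by (auto simp: image_iff Suc_le_eq gr0_conv_Suc)
    then show ?thesis by (simp add: G_def)
  qed
  have oG: "open (G j)" for j unfolding G_def using assms(7) by auto
  have "dyadically_full P \<mu> \<eta> (\<Inter>j. G j)" if \<eta>: "0 < \<eta>" "\<eta> < \<theta>" for \<eta>
  proof (rule dyadically_full_INT[OF assms(1) \<eta>(1) oG])
    fix j
    \<comment> \<open>Room between \<open>\<eta>\<close> and \<open>\<theta>\<close> for the larger exponent whose energy controls the small cubes.\<close>
    obtain \<eta>' where \<eta>': "\<eta> < \<eta>'" "\<eta>' < \<theta>" using dense[OF \<eta>(2)] by blast
    then obtain c where c: "\<And>n. dyadic_energy P \<mu> \<eta>' (\<mu>s n) \<le> ennreal c"
      using assms(12)[of \<eta>'] \<eta> by auto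
    show "dyadically_full P \<mu> \<eta> (G j)"
    proof (rule dyadically_full_of_bounded_energy[OF assms(1,4,8,11) \<eta>(1) \<eta>'(1) _ c])
      show "\<eta> \<le> 1" using \<eta> assms(6) by simp
      show "measure_support (\<mu>s n) \<subseteq> G j" if "Suc j \<le> n" for n
        using assms(10)[of n] that by (auto simp: G_def)
    qed
  qed
  moreover have "gdelta (\<Inter>j. G j)" using oG by (rule gdelta.intros)
  ultimately show ?thesis
    unfolding eq large_intersection_class_def by (auto intro: dyadic_content_eq_of_dyadically_full)
qed

end
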